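(* (ZFC) For every infinite regular cardinal $\kappa$ and every sequence $\bar p=\langle p_\delta:\delta<\kappa^+\rangle$ of partitions $p_\delta:[\kappa^+]^2\to n_\delta$ with $n_\delta<\omega$, $\kappa^+\nrightarrow_{\bar p}[\kappa^+\circledast\kappa^+]^2_{\kappa^+}$ holds. In particular, for every finite partition $p:[\omega_1]^2\to n$, both $\omega_1\nrightarrow_p[\omega_1\circledast\omega_1]^2_{\omega_1}$ and $\omega_1\nrightarrow_p[\omega_1]^2_{\omega_1}$ hold.
   Context: For $f:[\kappa]^2\to\lambda$ and $p:[\kappa]^2\to\theta$, $X\subseteq[\kappa]^2$ is $(f,p)$-strong if for every $\zeta:\theta\to\lambda$ there is $\{\alpha,\beta\}\in X$ with $f(\alpha,\beta)=\zeta(p(\alpha,\beta))$. $A\circledast B=\{\{\alpha,\beta\}:\alpha<\beta,\ \alpha\in A,\ \beta\in B\}$. $\kappa\nrightarrow_p[\mu]^2_\lambda$: there is $f:[\kappa]^2\to\lambda$ with $[A]^2$ $(f,p)$-strong for every $A\in[\kappa]^\mu$. $\kappa\nrightarrow_p[\mu_1\circledast\mu_2]^2_\lambda$: there is $f$ with $A\circledast B$ $(f,p)$-strong for all $A\in[\kappa]^{\mu_1}$, $B\in[\kappa]^{\mu_2}$. With a sequence $\bar p=\langle p_\delta\rangle$ in place of $p$: a single $f$ witnesses the symbol for each $p_\delta$. *)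

theory Defs
  imports Main
begin

text \<open>Ordinals below a cardinal are the field of a cardinal well-order r;
  alpha < beta means (alpha,beta) in r and alpha different from beta.
  Unordered pairs {alpha,beta} with alpha < beta are represented as ordered pairs (alpha,beta).\<close>

definition strong_pairs :: "'c set \<Rightarrow> ('b \<Rightarrow> 'b \<Rightarrow> 'c) \<Rightarrow> ('b \<Rightarrow> 'b \<Rightarrow> nat) \<Rightarrow> nat \<Rightarrow> ('b \<times> 'b) set \<Rightarrow> bool"
  where "strong_pairs lam f p n X \<equiv>
    \<forall>\<zeta>::nat \<Rightarrow> 'c. (\<forall>i<n. \<zeta> i \<in> lam) \<longrightarrow> (\<exists>(\<alpha>,\<beta>)\<in>X. f \<alpha> \<beta> = \<zeta> (p \<alpha> \<beta>))"

definition circ_pairs :: "'b rel \<Rightarrow> 'b set \<Rightarrow> 'b set \<Rightarrow> ('b \<times> 'b) set"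
  where "circ_pairs r A B = {(\<alpha>,\<beta>). \<alpha> \<in> A \<and> \<beta> \<in> B \<and> (\<alpha>,\<beta>) \<in> r \<and> \<alpha> \<noteq> \<beta>}"

text \<open>kappa -/->_pbar [mu1 circledast mu2]^2_lambda, where kappa is (the field of) r,
  pbar = (P delta : delta in I) with P delta : [kappa]^2 -> N delta, lambda is the colour set lam.\<close>
definition neg_arrow_circ ::
  "'b rel \<Rightarrow> ('i \<Rightarrow> 'b \<Rightarrow> 'b \<Rightarrow> nat) \<Rightarrow> ('i \<Rightarrow> nat) \<Rightarrow> 'i set \<Rightarrow> 'm1 rel \<Rightarrow> 'm2 rel \<Rightarrow> 'c set \<Rightarrow> bool"
  where "neg_arrow_circ r P N I mu1 mu2 lam \<equiv>
    \<exists>f. (\<forall>\<alpha>\<in>Field r. \<forall>\<beta>\<in>Field r. f \<alpha> \<beta> \<in> lam) \<and>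
      (\<forall>\<delta>\<in>I. \<forall>A B. A \<subseteq> Field r \<longrightarrow> B \<subseteq> Field r \<longrightarrow>
          (card_of A, mu1) \<in> ordIso \<longrightarrow> (card_of B, mu2) \<in> ordIso \<longrightarrow>
          strong_pairs lam f (P \<delta>) (N \<delta>) (circ_pairs r A B))"

definition neg_arrow_sq ::
  "'b rel \<Rightarrow> ('i \<Rightarrow> 'b \<Rightarrow> 'b \<Rightarrow> nat) \<Rightarrow> ('i \<Rightarrow> nat) \<Rightarrow> 'i set \<Rightarrow> 'm rel \<Rightarrow> 'c set \<Rightarrow> bool"
  where "neg_arrow_sq r P N I mu lam \<equiv>
    \<exists>f. (\<forall>\<alpha>\<in>Field r. \<forall>\<beta>\<in>Field r. f \<alpha> \<beta> \<in> lam) \<and>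
      (\<forall>\<delta>\<in>I. \<forall>A. A \<subseteq> Field r \<longrightarrow>
          (card_of A, mu) \<in> ordIso \<longrightarrow>
          strong_pairs lam f (P \<delta>) (N \<delta>) (circ_pairs r A A))"

end

theory Submission
  imports Defs
begin

text \<open>
  A finite list of colours together with an index of a partition can be coded by a single colour, so
  everything follows from the rectangular relation for the trivial partition: there is \<open>F\<close> such that
  \<open>F\<close> takes every value on \<open>A \<circledast> B\<close> for all \<open>A\<close>, \<open>B\<close> of size \<open>\<kappa>\<^sup>+\<close>.

  To construct \<open>F\<close>, walk from \<open>\<beta>\<close> to \<open>\<alpha>\<close> along a sequence of cofinal sets \<open>C \<beta>\<close> of order type at
  most \<open>\<kappa>\<close>. For \<open>\<delta>\<close> of cofinality \<open>\<kappa>\<close> and \<open>\<alpha> < \<delta>\<close> close enough to \<open>\<delta>\<close>, the walk from \<open>\<beta>\<close> to \<open>\<alpha>\<close>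
  passes through \<open>\<delta>\<close> after a number of steps that does not depend on \<open>\<alpha>\<close>. By pressing down this number
  is constant for stationarily many \<open>\<delta>\<close>, so it suffices to read it off from \<open>(\<alpha>, \<beta>)\<close>; the colour of
  \<open>(\<alpha>, \<beta>)\<close> is then the index of \<open>\<delta>\<close> in a partition of the points of cofinality \<open>\<kappa>\<close> into \<open>\<kappa>\<^sup>+\<close>
  stationary sets. The number of steps is obtained from Moore's oscillation: counting the
  alternations between \<open>e \<xi> \<alpha> \<le> e \<xi> \<beta>\<close> and \<open>e \<xi> \<alpha> > e \<xi> \<beta>\<close> for \<open>\<xi>\<close> in the lower trace of the walk,
  where \<open>e\<close> is coherent and \<open><\<kappa>\<close>-to-one, gives arbitrarily long intervals of integers on every
  rectangle, and the 2-adic valuation takes a given value on every sufficiently long interval.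
\<close>

unbundle cardinal_syntax

section \<open>Sequences of signs and dyadic valuations\<close>

fun rises :: "bool list \<Rightarrow> nat" where
  "rises (x # y # zs) = (if \<not> x \<and> y then 1 else 0) + rises (y # zs)"
| "rises _ = 0"

lemma rises_append: "xs \<noteq> [] \<Longrightarrow> rises (xs @ ys) = rises xs + rises (last xs # ys)"
  by (induction xs rule: rises.induct) auto

lemma rises_Cons_False: "set xs \<subseteq> {False} \<Longrightarrow> rises (x # xs) = 0"
  by (induction xs arbitrary: x) auto

lemma rises_Cons_True: "set xs \<subseteq> {True} \<Longrightarrow> xs \<noteq> [] \<Longrightarrow> rises (x # xs) = (if x then 0 else 1)"
proof (induction xs arbitrary: x)
  case (Cons y ys)
  then show ?case
    by (cases "ys = []") auto
qed simp

text \<open>The only new place where \<open>False\<close> is followed by \<open>True\<close> is the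
  boundary between \<open>fs\<close> and \<open>ts\<close>. The second conclusion allows
  iteration.\<close>

lemma rises_new_oscillation:
  assumes "xs \<noteq> []" "last xs" "set fs = {False}" "set ts = {True}"
  shows "rises (xs @ fs @ ts) = rises xs + 1" and "last (xs @ fs @ ts)"
proof -
  have ne: "fs \<noteq> []" "ts \<noteq> []"
    using assms(3,4) by force+
  have "last fs \<in> set fs" "last ts \<in> set ts"
    using ne by simp_all
  then have "\<not> last fs" "last ts"
    unfolding assms(3,4) by simp_all
  then show "last (xs @ fs @ ts)"
    using ne by simp
  have "rises ((last xs # fs) @ ts) = 1"
    using rises_append[of "last xs # fs" ts] rises_Cons_False[of fs] rises_Cons_True[of ts] assms ne \<open>\<not> last fs\<close>
    by simp
  then show "rises (xs @ fs @ ts) = rises xs + 1"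
    using rises_append[OF assms(1), of "fs @ ts"] by simp
qed

lemma set_constant_list: "set xs \<subseteq> {b} \<Longrightarrow> xs \<noteq> [] \<Longrightarrow> set xs = {b}"
  by (cases xs) auto

definition val2 :: "nat \<Rightarrow> nat" where "val2 x = (LEAST j. \<not> 2 ^ Suc j dvd x)"

text \<open>The number \<open>x\<close> chosen in the proof is the odd multiple of
  \<open>2 ^ j\<close> in the block of length \<open>2 ^ Suc j\<close> that follows the block
  containing \<open>m\<close>.\<close>

lemma val2_syndetic: "\<exists>n. \<forall>m. \<exists>i\<le>n. val2 (m + i) = j"
proof (rule exI[of _ "2 * 2 ^ Suc j"], rule allI)
  fix m
  define x :: nat where "x = 2 ^ Suc j * (m div 2 ^ Suc j + 1) + 2 ^ j"
  have "val2 x = j"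
    unfolding val2_def
  proof (rule Least_equality)
    show "\<not> 2 ^ Suc j dvd x"
      unfolding x_def by (subst dvd_add_right_iff) (auto dest: dvd_imp_le)
  next
    fix i assume i: "\<not> 2 ^ Suc i dvd x"
    show "j \<le> i"
    proof (rule ccontr)
      assume "\<not> j \<le> i"
      then have "(2::nat) ^ Suc i dvd 2 ^ j" "(2::nat) ^ Suc i dvd 2 ^ Suc j"
        by (auto intro!: le_imp_power_dvd simp del: power_Suc)
      then show False
        using i unfolding x_def by (meson dvd_add dvd_mult2)
    qed
  qed
  moreover have "m \<le> x" "x \<le> m + 2 * 2 ^ Suc j"
  proof -
    let ?q = "(2::nat) ^ Suc j"
    have "?q * (m div ?q) + m mod ?q = m" "m mod ?q < ?q"
      by (simp_all del: power_Suc)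
    moreover have "x = ?q * (m div ?q) + ?q + 2 ^ j" "(2::nat) ^ j \<le> ?q"
      by (simp_all add: x_def)
    ultimately show "m \<le> x" "x \<le> m + 2 * 2 ^ Suc j"
      by linarith+
  qed
  ultimately show "\<exists>i\<le>2 * 2 ^ Suc j. val2 (m + i) = j"
    by (intro exI[of _ "x - m"]) auto
qed

section \<open>Stationary subsets of a successor of a regular cardinal\<close>

text \<open>Lists of a fixed length are counted by induction, and there are countably many lengths.
  This bounds both the number of types that are pressed down and the number of codes for
  colours.\<close>

lemma card_of_lists_ordLeq_infinite:
  assumes "infinite B" "|X| \<le>o |B|"
  shows "|lists X| \<le>o |B|"
proof -
  have len: "|{xs \<in> lists X. length xs = n}| \<le>o |B|" for n
  proof (induction n)
    case 0
    have *: "{xs \<in> lists X. length xs = 0} = {[]}"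
      by auto
    have "B \<noteq> {}"
      using assms(1) by auto
    then show ?case
      unfolding * by (rule card_of_singl_ordLeq)
  next
    case (Suc n)
    have "{xs \<in> lists X. length xs = Suc n} \<subseteq> (\<lambda>(x, xs). x # xs) ` (X \<times> {xs \<in> lists X. length xs = n})"
    proof
      fix xs assume "xs \<in> {xs \<in> lists X. length xs = Suc n}"
      then obtain y ys where "xs = y # ys" "y \<in> X" "ys \<in> {xs \<in> lists X. length xs = n}"
        by (cases xs) auto
      then show "xs \<in> (\<lambda>(x, xs). x # xs) ` (X \<times> {xs \<in> lists X. length xs = n})"
        by (intro image_eqI[of _ _ "(y, ys)"]) auto
    qed
    then have "|{xs \<in> lists X. length xs = Suc n}| \<le>o |X \<times> {xs \<in> lists X. length xs = n}|"
      by (rule ordLeq_transitive[OF card_of_mono1 card_of_image])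
    also have "|X \<times> {xs \<in> lists X. length xs = n}| \<le>o |B|"
      using assms Suc by (intro card_of_Sigma_ordLeq_infinite ballI)
    finally show ?case .
  qed
  have "|\<Union>n. {xs \<in> lists X. length xs = n}| \<le>o |B|"
    by (rule card_of_UNION_ordLeq_infinite[OF assms(1) infinite_iff_card_of_nat[THEN iffD1, OF assms(1)]])
      (use len in blast)
  moreover have "lists X \<subseteq> (\<Union>n. {xs \<in> lists X. length xs = n})"
    by auto
  ultimately show ?thesis
    using ordLeq_transitive[OF card_of_mono1] by blast
qed

text \<open>\<open>K\<close> and \<open>W\<close> play kappa and kappa^+. Both are initial segments
  of one type of class \<open>wellorder\<close>, so \<open>LEAST\<close> and recursion along the
  order serve ordinals and indices alike.\<close>

locale succ_card =
  fixes W K :: "'b::wellorder set"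
  assumes K_subset: "K \<subseteq> W"
    and W_down: "x \<in> W \<Longrightarrow> y < x \<Longrightarrow> y \<in> W"
    and K_down: "x \<in> K \<Longrightarrow> y < x \<Longrightarrow> y \<in> K"
    and K_infinite: "infinite K"
    and K_regular: "regularCard |K|"
    and K_segment: "x \<in> K \<Longrightarrow> |{..<x}| <o |K|"
    and W_segment: "x \<in> W \<Longrightarrow> |{..<x}| \<le>o |K|"
    and K_less_W: "|K| <o |W|"
begin

section \<open>Sets of size less than kappa or at most kappa, and bounds in \<open>K\<close> and
  \<open>W\<close>\<close>

definition small :: "'c set \<Rightarrow> bool" where "small X \<longleftrightarrow> |X| <o |K|"
definition le_K :: "'c set \<Rightarrow> bool" where "le_K X \<longleftrightarrow> |X| \<le>o |K|"
definition unbounded :: "'b set \<Rightarrow> bool" where "unbounded X \<longleftrightarrow> X \<subseteq> W \<and> (\<forall>z\<in>W. \<exists>x\<in>X. z < x)"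

lemma W_down_le: "x \<in> W \<Longrightarrow> y \<le> x \<Longrightarrow> y \<in> W"
  using W_down by (auto simp: le_less)

lemma small_subset: "small Y \<Longrightarrow> X \<subseteq> Y \<Longrightarrow> small X"
  unfolding small_def by (meson card_of_mono1 ordLeq_ordLess_trans)

lemma le_K_subset: "le_K Y \<Longrightarrow> X \<subseteq> Y \<Longrightarrow> le_K X"
  unfolding le_K_def by (meson card_of_mono1 ordLeq_transitive)

lemma finite_small: "finite X \<Longrightarrow> small X"
  unfolding small_def 
  by (rule finite_ordLess_infinite) (use K_infinite in \<open>simp_all add: Field_card_of card_of_well_order_on\<close>)

lemma small_le_K: "small X \<Longrightarrow> le_K X"
  unfolding small_def le_K_def by (rule ordLess_imp_ordLeq)

lemma le_K_refl: "le_K K"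
  unfolding le_K_def by (rule ordIso_imp_ordLeq) (rule card_of_refl)

lemma small_image: "small X \<Longrightarrow> small (f ` X)"
  unfolding small_def by (meson card_of_image ordLeq_ordLess_trans)

lemma le_K_image: "le_K X \<Longrightarrow> le_K (f ` X)"
  unfolding le_K_def by (meson card_of_image ordLeq_transitive)

lemma small_UN:
  assumes "small I" "\<And>i. i \<in> I \<Longrightarrow> small (F i)"
  shows "small (\<Union>i\<in>I. F i)"
proof -
  have "stable |K|"
    using K_regular K_infinite by (intro regularCard_stable card_of_Card_order) (auto simp: Field_card_of)
  then show ?thesis
    using assms stable_UNION unfolding small_def by blast
qed

lemma small_Un: "small X \<Longrightarrow> small Y \<Longrightarrow> small (X \<union> Y)"
  unfolding small_def using K_infinite card_of_Un_ordLess_infinite by blast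

lemma small_insert: "small X \<Longrightarrow> small (insert x X)"
  using small_Un[of "{x}" X] by (simp add: finite_small)

lemma le_K_UN:
  assumes "le_K I" "\<And>i. i \<in> I \<Longrightarrow> le_K (F i)"
  shows "le_K (\<Union>i\<in>I. F i)"
  using assms card_of_UNION_ordLeq_infinite K_infinite unfolding le_K_def by blast

lemma le_K_Un: "le_K X \<Longrightarrow> le_K Y \<Longrightarrow> le_K (X \<union> Y)"
  using le_K_UN[of "UNIV::bool set" "\<lambda>b. if b then X else Y"]
  by (auto simp: finite_small small_le_K UNIV_bool Un_commute)

lemma le_K_Times:
  assumes "le_K X" "le_K Y"
  shows "le_K (X \<times> Y)"
  using assms card_of_Sigma_ordLeq_infinite[OF K_infinite, of X "\<lambda>_. Y"] unfolding le_K_def by blast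

lemma le_K_nat: "le_K (X::nat set)"
proof -
  have "le_K (UNIV::nat set)"
    unfolding le_K_def using K_infinite infinite_iff_card_of_nat by blast
  then show ?thesis
    using le_K_subset by blast
qed

lemma le_K_lists: "le_K X \<Longrightarrow> le_K (lists X)"
  unfolding le_K_def using K_infinite by (rule card_of_lists_ordLeq_infinite)

lemma K_bounded:
  assumes "X \<subseteq> K" "small X"
  shows "\<exists>z\<in>K. \<forall>x\<in>X. x < z"
proof (rule ccontr)
  assume "\<not> ?thesis"
  then have "K \<subseteq> (\<Union>x\<in>X. insert x {..<x})"
    by (simp add: subset_iff Bex_def not_less) (metis antisym_conv2)
  moreover have "small (\<Union>x\<in>X. insert x {..<x})"
    using assms K_segment small_def by (intro small_UN small_insert) auto
  ultimately have "small K"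
    using small_subset by blast
  then show False
    unfolding small_def by (simp add: ordLess_irreflexive)
qed

lemma W_atMost: "x \<in> W \<Longrightarrow> le_K {..x}"
  using W_segment[of x] le_K_Un[of "{..<x}" "{x}"] finite_small[THEN small_le_K, of "{x}"]
  by (simp only: le_K_def ivl_disj_un finite.intros)

text \<open>Otherwise \<open>W\<close> would be covered by at most kappa initial segments, each of
  size at most kappa. This is the regularity of kappa^+.\<close>

lemma unbounded_not_le_K:
  assumes "unbounded X"
  shows "\<not> le_K X"
proof
  assume "le_K X"
  have "W \<subseteq> (\<Union>x\<in>X. {..x})"
    using assms unfolding unbounded_def by fastforce
  moreover have "le_K (\<Union>x\<in>X. {..x})"
    using assms \<open>le_K X\<close> W_atMost unfolding unbounded_def by (intro le_K_UN) auto
  ultimately have "|W| \<le>o |K|"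
    using le_K_subset le_K_def by blast
  then show False
    using K_less_W not_ordLeq_ordLess by blast
qed

lemma W_bounded:
  assumes "X \<subseteq> W" "le_K X"
  shows "\<exists>z\<in>W. \<forall>x\<in>X. x < z"
proof -
  obtain z where z: "z \<in> W" "\<forall>x\<in>X. x \<le> z"
    using unbounded_not_le_K[of X] assms unfolding unbounded_def by (meson not_less)
  obtain y where "y \<in> W" "z < y"
  proof -
    have "\<not> W \<subseteq> {..z}"
      using W_atMost[OF z(1)] K_less_W le_K_def le_K_subset not_ordLeq_ordLess by blast
    then show ?thesis
      using that by fastforce
  qed
  then show ?thesis
    using z by force
qed

lemma W_above: "x \<in> W \<Longrightarrow> \<exists>y\<in>W. x < y"
  using W_bounded[of "{x}"] by (simp add: finite_small small_le_K)

lemma K_above: "x \<in> K \<Longrightarrow> \<exists>y\<in>K. x < y"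
  using K_bounded[of "{x}"] by (simp add: finite_small)

lemma unbounded_W: "unbounded W"
  unfolding unbounded_def using W_above by blast

section \<open>Splitting and counting unbounded sets\<close>

lemma unbounded_inter:
  assumes "unbounded X" "z \<in> W"
  shows "unbounded {x \<in> X. z < x}"
  unfolding unbounded_def
proof (intro conjI ballI)
  fix y assume "y \<in> W"
  then have "max y z \<in> W"
    using assms by (simp add: max_def)
  then obtain x where "x \<in> X" "max y z < x"
    using assms unfolding unbounded_def by blast
  then show "\<exists>x\<in>{x \<in> X. z < x}. y < x"
    by auto
qed (use assms unbounded_def in auto)

lemma unbounded_pigeonhole:
  assumes "unbounded X" "le_K I" "\<And>x. x \<in> X \<Longrightarrow> f x \<in> I"
  shows "\<exists>i\<in>I. unbounded {x \<in> X. f x = i}"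
proof (rule ccontr)
  assume "\<not> ?thesis"
  then have "\<forall>i\<in>I. \<exists>z\<in>W. \<forall>x\<in>X. f x = i \<longrightarrow> x \<le> z"
    using assms(1) unfolding unbounded_def by (simp add: not_less Ball_def) blast
  then obtain z where z: "\<And>i. i \<in> I \<Longrightarrow> z i \<in> W" "\<And>i x. i \<in> I \<Longrightarrow> x \<in> X \<Longrightarrow> f x = i \<Longrightarrow> x \<le> z i"
    by metis
  obtain y where "y \<in> W" "\<forall>x\<in>z ` I. x < y"
    using W_bounded[of "z ` I"] z(1) assms(2) le_K_image by blast
  moreover obtain x where "x \<in> X" "y < x"
    using assms(1) \<open>y \<in> W\<close> unfolding unbounded_def by blast
  ultimately show False
    using z(2) assms(3) by fastforce
qed

lemma unbounded_card:
  assumes "unbounded X"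
  shows "|W| \<le>o |X|"
proof -
  have "\<not> le_K X"
    using assms by (rule unbounded_not_le_K)
  then have KX: "|K| \<le>o |X|"
    unfolding le_K_def using ordLeq_total card_of_Well_order by blast
  then have inf: "infinite X"
    using K_infinite card_of_ordLeq_finite by blast
  have "\<forall>x\<in>X. |{..x}| \<le>o |X|"
    using assms W_atMost KX ordLeq_transitive unfolding unbounded_def le_K_def by blast
  then have "|\<Union>x\<in>X. {..x}| \<le>o |X|"
    using inf card_of_UNION_ordLeq_infinite card_of_refl ordIso_iff_ordLeq by blast
  moreover have "W \<subseteq> (\<Union>x\<in>X. {..x})"
    using assms unfolding unbounded_def by fastforce
  ultimately show ?thesis
    using card_of_mono1 ordLeq_transitive by blast
qed

lemma card_unbounded:
  assumes "X \<subseteq> W" "|X| =o |W|"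
  shows "unbounded X"
proof (rule ccontr)
  assume "\<not> unbounded X"
  then obtain z where "z \<in> W" "X \<subseteq> {..z}"
    using assms(1) unfolding unbounded_def by (auto simp: not_less)
  then have "le_K X"
    using W_atMost le_K_subset by blast
  then show False
    using assms K_less_W unfolding le_K_def
    by (meson not_ordLeq_ordLess ordIso_ordLeq_trans ordIso_symmetric)
qed

text \<open>Equivalent to the usual notion: the closure points of a function form a closed unbounded set,
  and every closed unbounded set contains all closure points of some function.\<close>

definition stationary :: "'b set \<Rightarrow> bool" where
  "stationary Z \<longleftrightarrow> Z \<subseteq> W \<and>
     (\<forall>h. (\<forall>x\<in>W. h x \<in> W) \<longrightarrow> (\<forall>z\<in>W. \<exists>g\<in>Z. z < g \<and> (\<forall>x<g. h x < g)))"

lemma stationaryD: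
  assumes "stationary Z" "\<And>x. x \<in> W \<Longrightarrow> h x \<in> W" "z \<in> W"
  obtains g where "g \<in> Z" "z < g" "\<And>x. x < g \<Longrightarrow> h x < g"
proof -
  have "\<forall>x\<in>W. h x \<in> W"
    using assms(2) by blast
  then have "\<exists>g\<in>Z. z < g \<and> (\<forall>x<g. h x < g)"
    using assms(1,3) unfolding stationary_def by (elim conjE allE[of _ h]) blast
  then show thesis
    using that by blast
qed

lemma stationary_W: "stationary Z \<Longrightarrow> g \<in> Z \<Longrightarrow> g \<in> W"
  unfolding stationary_def by blast

lemma stationary_unbounded: "stationary Z \<Longrightarrow> unbounded Z"
  unfolding unbounded_def
proof (intro conjI subsetI ballI)
  fix z assume "stationary Z" "z \<in> W"
  then obtain g where "g \<in> Z" "z < g"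
    using stationaryD[of Z "\<lambda>x. x" z] by auto
  then show "\<exists>x\<in>Z. z < x"
    by blast
qed (rule stationary_W)

lemma stationary_closed:
  assumes "stationary Z" "\<And>x. x \<in> W \<Longrightarrow> h x \<in> W" "z \<in> W"
  shows "stationary {g \<in> Z. z < g \<and> (\<forall>x<g. h x < g)}"
  unfolding stationary_def
proof (intro conjI allI impI ballI)
  fix h' :: "'b \<Rightarrow> 'b" and z' assume h': "\<forall>x\<in>W. h' x \<in> W" and z': "z' \<in> W"
  obtain g where "g \<in> Z" "max z z' < g" "\<And>x. x < g \<Longrightarrow> max (h x) (h' x) < g"
    by (rule stationaryD[OF assms(1), of "\<lambda>x. max (h x) (h' x)" "max z z'"])
      (use assms h' z' in \<open>auto simp: max_def\<close>)
  then show "\<exists>g\<in>{g \<in> Z. z < g \<and> (\<forall>x<g. h x < g)}. z' < g \<and> (\<forall>x<g. h' x < g)"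
    by auto
qed (use assms stationary_def in auto)

lemma not_stationary:
  assumes "\<not> stationary Z" "Z \<subseteq> W"
  shows "\<exists>h z. (\<forall>x\<in>W. h x \<in> W) \<and> z \<in> W \<and> (\<forall>g\<in>Z. z < g \<longrightarrow> (\<exists>x<g. g \<le> h x))"
proof -
  obtain h where "\<forall>x\<in>W. h x \<in> W" "\<not> (\<forall>z\<in>W. \<exists>g\<in>Z. z < g \<and> (\<forall>x<g. h x < g))"
    using assms unfolding stationary_def by blast
  then show ?thesis
    by (intro exI[of _ h]) (metis not_less)
qed

lemma stationary_mono:
  assumes "stationary Z" "Z \<subseteq> Y" "Y \<subseteq> W"
  shows "stationary Y"
  unfolding stationary_def
proof (intro conjI allI impI ballI)
  fix h z assume "\<forall>x\<in>W. h x \<in> W" "z \<in> W"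
  then obtain g where "g \<in> Z" "z < g" "\<And>x. x < g \<Longrightarrow> h x < g"
    using stationaryD[OF assms(1), of h z] by blast
  then show "\<exists>g\<in>Y. z < g \<and> (\<forall>x<g. h x < g)"
    using assms(2) by blast
qed (rule assms(3))

text \<open>Pressing down for values of any type: \<open>X z\<close> collects the at most kappa
  values available by stage \<open>z\<close>, for instance pairs or finite lists built from ordinals
  up to \<open>z\<close>. The proof is a diagonal intersection phrased with closure points.\<close>

lemma fodor:
  assumes "stationary Z"
    and X: "\<And>z. z \<in> W \<Longrightarrow> le_K (X z)" "\<And>z z'. z \<le> z' \<Longrightarrow> X z \<subseteq> X z'"
    and f: "\<And>g. g \<in> Z \<Longrightarrow> \<exists>z<g. f g \<in> X z"
  shows "\<exists>y. stationary {g \<in> Z. f g = y}"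
proof (rule ccontr)
  assume "\<not> ?thesis"
  then have "\<forall>y. \<exists>h z. (\<forall>x\<in>W. h x \<in> W) \<and> z \<in> W \<and>
      (\<forall>g\<in>{g \<in> Z. f g = y}. z < g \<longrightarrow> (\<exists>x<g. g \<le> h x))"
    using assms(1) by (intro allI not_stationary) (auto dest: stationary_W)
  then obtain h z where h: "\<And>y x. x \<in> W \<Longrightarrow> h y x \<in> W" and z: "\<And>y. z y \<in> W"
    and hz: "\<And>y g. g \<in> Z \<Longrightarrow> f g = y \<Longrightarrow> z y < g \<Longrightarrow> \<exists>x<g. g \<le> h y x"
    unfolding mem_Collect_eq Ball_def by metis
  \<comment> \<open>\<open>H t\<close> will dominate the data witnessing non-stationarity for all
    values in \<open>X t\<close>, evaluated at arguments up to \<open>t\<close>.\<close>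
  have "\<exists>u\<in>W. \<forall>y\<in>X t. z y < u \<and> (\<forall>x\<le>t. h y x < u)" if "t \<in> W" for t
  proof -
    let ?U = "z ` X t \<union> (\<lambda>(y, x). h y x) ` (X t \<times> {..t})"
    have "?U \<subseteq> W"
      using z h that W_down_le[OF that] by auto
    moreover have "le_K ?U"
      using X(1)[OF that] W_atMost[OF that] by (intro le_K_Un le_K_image le_K_Times)
    ultimately obtain u where "u \<in> W" "\<forall>x\<in>?U. x < u"
      using W_bounded by meson
    then show ?thesis
      by (intro bexI[of _ u]) auto
  qed
  then obtain H where H: "\<And>t. t \<in> W \<Longrightarrow> H t \<in> W" "\<And>t y. t \<in> W \<Longrightarrow> y \<in> X t \<Longrightarrow> z y < H t"
      "\<And>t x y. t \<in> W \<Longrightarrow> y \<in> X t \<Longrightarrow> x \<le> t \<Longrightarrow> h y x < H t"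
    by metis
  obtain g where g: "g \<in> Z" "\<And>x. x < g \<Longrightarrow> H x < g"
    by (rule stationaryD[OF assms(1), of H "z undefined"]) (use H(1) z in auto)
  obtain t where t: "t < g" "f g \<in> X t"
    using f[OF g(1)] by blast
  have gW: "t \<in> W" if "t < g" for t
    using stationary_W[OF assms(1) g(1)] W_down that by blast
  have "z (f g) < g"
    using H(2)[OF gW[OF t(1)] t(2)] g(2)[OF t(1)] by order
  then obtain x where x: "x < g" "g \<le> h (f g) x"
    using hz[OF g(1) refl] by blast
  \<comment> \<open>A stage below \<open>g\<close> that is late enough both for the value
    \<open>f g\<close> and for the argument \<open>x\<close>.\<close>
  define s where "s = max t x"
  have "s < g" "f g \<in> X s" "x \<le> s"
    using t x X(2)[of t s] by (auto simp: s_def)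
  then have "h (f g) x < H s" "H s < g"
    using H(3) g(2) gW by blast+
  then show False
    using x(2) by order
qed

lemma fodor_le_K:
  assumes "stationary Z" "le_K X" "\<And>g. g \<in> Z \<Longrightarrow> f g \<in> X"
  shows "\<exists>y\<in>X. stationary {g \<in> Z. f g = y}"
proof -
  obtain z where z: "z \<in> W"
    using K_subset K_infinite by fastforce
  \<comment> \<open>Above \<open>z\<close> every point has an ordinal below it, as
    \<open>fodor\<close> demands even for a constant family of values.\<close>
  have Z': "stationary {g \<in> Z. z < g}"
    using stationary_closed[OF assms(1), of "\<lambda>x. x" z] z by (simp add: conj_commute)
  obtain y where y: "stationary {g \<in> {g \<in> Z. z < g}. f g = y}"
    using fodor[OF Z', of "\<lambda>_. X" f] assms by auto
  then have "stationary {g \<in> Z. f g = y}"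
    by (rule stationary_mono) (use assms(1) stationary_W in auto)
  moreover have "y \<in> X"
  proof -
    obtain g where "g \<in> Z" "f g = y"
      using stationaryD[OF y, of "\<lambda>x. x" z] z by auto
    then show ?thesis
      using assms(3) by blast
  qed
  ultimately show ?thesis
    by blast
qed

section \<open>Coherent functions and points of full cofinality\<close>

definition E :: "'b \<Rightarrow> 'b \<Rightarrow> 'b" where
  "E \<beta> = (SOME f. inj_on f {..<\<beta>} \<and> f ` {..<\<beta>} \<subseteq> K)"

lemma E:
  assumes "\<beta> \<in> W"
  shows E_inj: "inj_on (E \<beta>) {..<\<beta>}" and E_K: "x < \<beta> \<Longrightarrow> E \<beta> x \<in> K"
proof -
  have "\<exists>f. inj_on f {..<\<beta>} \<and> f ` {..<\<beta>} \<subseteq> K"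
    using W_segment[OF assms] card_of_ordLeq by blast
  then have "inj_on (E \<beta>) {..<\<beta>} \<and> E \<beta> ` {..<\<beta>} \<subseteq> K"
    unfolding E_def by (rule someI_ex)
  then show "inj_on (E \<beta>) {..<\<beta>}" "x < \<beta> \<Longrightarrow> E \<beta> x \<in> K"
    by auto
qed

lemma K_atMost: "\<nu> \<in> K \<Longrightarrow> small {..\<nu>}"
  using K_segment[of \<nu>] small_insert[of "{..<\<nu>}" \<nu>] by (simp add: small_def lessThan_Suc_atMost ivl_disj_un flip: ivl_disj_un(2))

lemma small_E_le:
  assumes "\<beta> \<in> W" "\<nu> \<in> K"
  shows "small {x. x < \<beta> \<and> E \<beta> x \<le> \<nu>}"
proof -
  have "inj_on (E \<beta>) {x. x < \<beta> \<and> E \<beta> x \<le> \<nu>}"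
    using E_inj[OF assms(1)] by (rule inj_on_subset) auto
  moreover have "E \<beta> ` {x. x < \<beta> \<and> E \<beta> x \<le> \<nu>} \<subseteq> {..\<nu>}"
    by auto
  ultimately have "|{x. x < \<beta> \<and> E \<beta> x \<le> \<nu>}| \<le>o |{..\<nu>}|"
    using card_of_ordLeq by blast
  then show ?thesis
    using K_atMost[OF assms(2)] unfolding small_def by (rule ordLeq_ordLess_trans)
qed

text \<open>The records of the enumeration of \<open>\<beta>\<close> given by \<open>E \<beta>\<close> form a cofinal subset of order type
  at most the order type of \<open>K\<close>.\<close>

definition C :: "'b \<Rightarrow> 'b set" where
  "C \<beta> = {x. x < \<beta> \<and> (\<forall>y<\<beta>. E \<beta> y < E \<beta> x \<longrightarrow> y < x)}"

lemma C_less: "x \<in> C \<beta> \<Longrightarrow> x < \<beta>"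
  by (simp add: C_def)

text \<open>The point of least index in the interval from \<open>x\<close> to \<open>\<beta>\<close>
  is a record. Records below \<open>x\<close> have no larger index, so each proper initial segment
  of \<open>C \<beta>\<close> has size less than kappa.\<close>

lemma C_least_index:
  assumes "\<beta> \<in> W" "x < \<beta>"
  shows "\<exists>y. y \<in> C \<beta> \<and> x \<le> y \<and> (\<forall>z\<in>C \<beta>. z < x \<longrightarrow> E \<beta> z \<le> E \<beta> y)"
proof -
  define v where "v = (LEAST v. \<exists>y. x \<le> y \<and> y < \<beta> \<and> v = E \<beta> y)"
  have "\<exists>y. x \<le> y \<and> y < \<beta> \<and> v = E \<beta> y"
    unfolding v_def by (rule LeastI[of _ "E \<beta> x"]) (use assms in auto)
  then obtain y where y: "x \<le> y" "y < \<beta>" "v = E \<beta> y"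
    by blast
  have least: "E \<beta> y \<le> E \<beta> z" if "x \<le> z" "z < \<beta>" for z
    unfolding y(3)[symmetric] v_def by (rule Least_le) (use that in auto)
  have "z < y" if "z < \<beta>" "E \<beta> z < E \<beta> y" for z
    using least[of z] that y(1) by (meson leI leD less_le_trans)
  then have "y \<in> C \<beta>"
    using y(2) by (simp add: C_def)
  moreover have "E \<beta> z \<le> E \<beta> y" if "z \<in> C \<beta>" "z < x" for z
    using that y by (auto simp: C_def not_less[symmetric])
  ultimately show ?thesis
    using y(1) by blast
qed

lemma C_cofinal: "\<beta> \<in> W \<Longrightarrow> x < \<beta> \<Longrightarrow> \<exists>y\<in>C \<beta>. x \<le> y"
  using C_least_index by blast

lemma C_small:
  assumes "\<beta> \<in> W" "\<alpha> < \<beta>"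
  shows "small {x \<in> C \<beta>. x < \<alpha>}"
proof -
  obtain y where y: "y \<in> C \<beta>" "\<forall>z\<in>C \<beta>. z < \<alpha> \<longrightarrow> E \<beta> z \<le> E \<beta> y"
    using C_least_index[OF assms] by blast
  then have "{x \<in> C \<beta>. x < \<alpha>} \<subseteq> {x. x < \<beta> \<and> E \<beta> x \<le> E \<beta> y}"
    using C_less by blast
  then show ?thesis
    using small_E_le[OF assms(1) E_K[OF assms(1) C_less[OF y(1)]]] small_subset by blast
qed

section \<open>Single steps of walks and the coherent function \<open>e\<close>\<close>

definition next_step :: "'b \<Rightarrow> 'b \<Rightarrow> 'b" where
  "next_step \<alpha> \<beta> = (LEAST c. c \<in> C \<beta> \<and> \<alpha> \<le> c)"

lemma next_step:
  assumes "\<beta> \<in> W" "\<alpha> < \<beta>"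
  shows next_step_C: "next_step \<alpha> \<beta> \<in> C \<beta>" and next_step_ge: "\<alpha> \<le> next_step \<alpha> \<beta>"
    and next_step_le: "c \<in> C \<beta> \<Longrightarrow> \<alpha> \<le> c \<Longrightarrow> next_step \<alpha> \<beta> \<le> c"
    and next_step_less: "next_step \<alpha> \<beta> < \<beta>"
proof -
  have "\<exists>c. c \<in> C \<beta> \<and> \<alpha> \<le> c"
    using C_cofinal[OF assms] by blast
  from LeastI_ex[OF this] show "next_step \<alpha> \<beta> \<in> C \<beta>" "\<alpha> \<le> next_step \<alpha> \<beta>"
    unfolding next_step_def by auto
  then show "next_step \<alpha> \<beta> < \<beta>"
    using C_less by blast
  show "next_step \<alpha> \<beta> \<le> c" if "c \<in> C \<beta>" "\<alpha> \<le> c"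
    unfolding next_step_def using that by (auto intro: Least_le)
qed

lemma next_step_W: "\<beta> \<in> W \<Longrightarrow> \<alpha> < \<beta> \<Longrightarrow> next_step \<alpha> \<beta> \<in> W"
  using next_step_less W_down by blast

text \<open>This is Todorcevic's function \<open>\<rho>\<^sub>1\<close>, with order types of initial segments of \<open>C \<beta>\<close> replaced by
  the indices \<open>E \<beta>\<close>.\<close>

definition e :: "'b \<Rightarrow> 'b \<Rightarrow> 'b" where
  "e \<xi> = wfrec {(x, y). x < y} (\<lambda>f \<beta>.
     if \<beta> \<in> W \<and> \<xi> < \<beta> then max (E \<beta> (next_step \<xi> \<beta>)) (f (next_step \<xi> \<beta>)) else (LEAST x. True))"

lemma e_rec: "e \<xi> \<beta> = (if \<beta> \<in> W \<and> \<xi> < \<beta> then max (E \<beta> (next_step \<xi> \<beta>)) (e \<xi> (next_step \<xi> \<beta>)) else (LEAST x. True))"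
  by (subst def_wfrec[OF e_def[THEN eq_reflection] wf]) (auto simp: cut_def next_step_less)

lemma e_less: "\<beta> \<in> W \<Longrightarrow> \<xi> < \<beta> \<Longrightarrow> e \<xi> \<beta> = max (E \<beta> (next_step \<xi> \<beta>)) (e \<xi> (next_step \<xi> \<beta>))"
  by (subst e_rec) simp

lemma e_K: "e \<xi> \<beta> \<in> K"
proof (induction \<beta> rule: less_induct)
  case (less \<beta>)
  show ?case
  proof (cases "\<beta> \<in> W \<and> \<xi> < \<beta>")
    case True
    then show ?thesis
      using less[of "next_step \<xi> \<beta>"] E_K next_step_less by (simp add: e_less max_def)
  next
    case False
    \<comment> \<open>The default value is the minimum of the type, which lies in \<open>K\<close>
      since \<open>K\<close> is nonempty and closed downwards.\<close>
    obtain x where "x \<in> K"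
      using K_infinite by fastforce
    moreover have "(LEAST x. True) \<le> x"
      by (rule Least_le) simp
    ultimately show ?thesis
      using False K_down by (subst e_rec) (auto simp: le_less)
  qed
qed

text \<open>If \<open>e \<xi> \<beta> \<le> \<nu>\<close>, the first step \<open>c\<close> from
  \<open>\<beta>\<close> towards \<open>\<xi>\<close> has index at most \<open>\<nu>\<close>. So
  there are fewer than kappa such \<open>c\<close>; induction treats each one, and regularity of
  kappa combines them.\<close>

lemma small_e_le:
  assumes "\<beta> \<in> W" "\<nu> \<in> K"
  shows "small {\<xi>. \<xi> < \<beta> \<and> e \<xi> \<beta> \<le> \<nu>}"
  using assms(1)
proof (induction \<beta> rule: less_induct)
  case (less \<beta>)
  have "{\<xi>. \<xi> < \<beta> \<and> e \<xi> \<beta> \<le> \<nu>} \<subseteq>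
      (\<Union>c\<in>{c. c < \<beta> \<and> E \<beta> c \<le> \<nu>}. insert c {\<xi>. \<xi> < c \<and> e \<xi> c \<le> \<nu>})"
  proof
    fix \<xi> assume "\<xi> \<in> {\<xi>. \<xi> < \<beta> \<and> e \<xi> \<beta> \<le> \<nu>}"
    then show "\<xi> \<in> (\<Union>c\<in>{c. c < \<beta> \<and> E \<beta> c \<le> \<nu>}. insert c {\<xi>. \<xi> < c \<and> e \<xi> c \<le> \<nu>})"
      using next_step_less[of \<beta> \<xi>] le_imp_less_or_eq[OF next_step_ge[of \<beta> \<xi>]] less.prems
      by (intro UN_I[of "next_step \<xi> \<beta>"]) (auto simp: e_less)
  qed
  moreover have "small (\<Union>c\<in>{c. c < \<beta> \<and> E \<beta> c \<le> \<nu>}. insert c {\<xi>. \<xi> < c \<and> e \<xi> c \<le> \<nu>})"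
    using less W_down by (intro small_UN small_E_le assms small_insert) auto
  ultimately show ?case
    using small_subset by blast
qed

text \<open>The first step \<open>c\<close> from \<open>\<beta>\<close> towards some
  \<open>\<xi> < \<alpha>\<close> is either in \<open>C \<beta>\<close> below
  \<open>\<alpha>\<close> or equal to \<open>next_step \<alpha> \<beta>\<close>, so fewer than kappa
  \<open>c\<close> occur. For fixed \<open>c\<close>, \<open>e \<xi> \<beta>\<close> equals
  \<open>e \<xi> c\<close> except at fewer than kappa places, and \<open>c\<close> is compared with
  \<open>\<alpha>\<close> by induction at the larger of the two.\<close>

lemma e_coherent:
  assumes "\<beta> \<in> W" "\<alpha> < \<beta>"
  shows "small {\<xi>. \<xi> < \<alpha> \<and> e \<xi> \<alpha> \<noteq> e \<xi> \<beta>}"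
  using assms
proof (induction \<beta> arbitrary: \<alpha> rule: less_induct)
  case (less \<beta>)
  let ?I = "insert (next_step \<alpha> \<beta>) {c \<in> C \<beta>. c < \<alpha>}"
  let ?D = "\<lambda>c. insert c ({\<xi>. \<xi> < c \<and> e \<xi> c \<le> E \<beta> c} \<union> {\<xi>. \<xi> < c \<and> \<xi> < \<alpha> \<and> e \<xi> c \<noteq> e \<xi> \<alpha>})"
  have "{\<xi>. \<xi> < \<alpha> \<and> e \<xi> \<alpha> \<noteq> e \<xi> \<beta>} \<subseteq> (\<Union>c\<in>?I. ?D c)"
  proof
    fix \<xi> assume "\<xi> \<in> {\<xi>. \<xi> < \<alpha> \<and> e \<xi> \<alpha> \<noteq> e \<xi> \<beta>}"
    then have \<xi>: "\<xi> < \<alpha>" "e \<xi> \<alpha> \<noteq> e \<xi> \<beta>" "\<xi> < \<beta>"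
      using less.prems by auto
    let ?c = "next_step \<xi> \<beta>"
    have "?c \<in> ?I"
    proof (cases "?c < \<alpha>")
      case False
      then have "?c = next_step \<alpha> \<beta>"
        using next_step_le[of \<beta> \<xi> "next_step \<alpha> \<beta>"] next_step_le[of \<beta> \<alpha> "?c"] next_step_C next_step_ge[of \<beta> \<alpha>] \<xi> less.prems
        by (intro antisym) auto
      then show ?thesis
        by simp
    qed (use next_step_C \<xi> less.prems in auto)
    moreover have "\<xi> \<in> ?D ?c"
      using \<xi> le_imp_less_or_eq[OF next_step_ge[of \<beta> \<xi>]] less.prems
      by (auto simp: e_less max_def split: if_splits)
    ultimately show "\<xi> \<in> (\<Union>c\<in>?I. ?D c)"
      by blast
  qed
  moreover have "small (\<Union>c\<in>?I. ?D c)"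
  proof (rule small_UN)
    show "small ?I"
      using C_small less.prems by (intro small_insert) auto
  next
    fix c assume "c \<in> ?I"
    then have c: "c < \<beta>" "c \<in> W"
      using next_step_less less.prems C_less W_down by auto
    have "small {\<xi>. \<xi> < c \<and> \<xi> < \<alpha> \<and> e \<xi> c \<noteq> e \<xi> \<alpha>}"
    proof (cases c \<alpha> rule: linorder_cases)
      case less
      then have "small {\<xi>. \<xi> < c \<and> e \<xi> c \<noteq> e \<xi> \<alpha>}"
        using less.IH[of \<alpha> c] less.prems W_down by blast
      then show ?thesis
        by (rule small_subset) auto
    next
      case equal
      then show ?thesis
        by (simp add: finite_small)
    next
      case greater
      then have "small {\<xi>. \<xi> < \<alpha> \<and> e \<xi> \<alpha> \<noteq> e \<xi> c}"
        using less.IH[of c \<alpha>] c by blast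
      then show ?thesis
        by (rule small_subset) auto
    qed
    then show "small (?D c)"
      using small_e_le[OF c(2) E_K[OF less.prems(1) c(1)]] by (intro small_insert small_Un) auto
  qed
  ultimately show ?case
    using small_subset by blast
qed

text \<open>These are the ordinals below kappa^+ of cofinality kappa; the empty \<open>X\<close>
  excludes zero, singletons exclude successors.\<close>

definition S :: "'b set" where
  "S = {\<delta> \<in> W. \<forall>X. X \<subseteq> {..<\<delta>} \<and> small X \<longrightarrow> (\<exists>\<xi><\<delta>. \<forall>x\<in>X. x < \<xi>)}"

lemma S_W: "\<delta> \<in> S \<Longrightarrow> \<delta> \<in> W"
  by (simp add: S_def)

lemma S_bounded:
  assumes "\<delta> \<in> S" "small X" "\<And>x. x \<in> X \<Longrightarrow> x < \<delta>"
  shows "\<exists>\<xi><\<delta>. \<forall>x\<in>X. x < \<xi>"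
  using assms unfolding S_def by blast

lemma S_finite_bounded:
  assumes "\<delta> \<in> S" "finite X" "\<And>x. x \<in> X \<Longrightarrow> x < \<delta>"
  shows "\<exists>\<xi><\<delta>. \<forall>x\<in>X. x < \<xi>"
  using S_bounded assms finite_small by blast

text \<open>Closing off under \<open>h\<close> along an increasing sequence of length kappa leads to
  a closure point of \<open>h\<close>, which has cofinality kappa because kappa is regular.\<close>

lemma stationary_S: "stationary S"
  unfolding stationary_def
proof (intro conjI allI impI ballI)
  show "S \<subseteq> W"
    by (simp add: S_def)
next
  fix h :: "'b \<Rightarrow> 'b" and z assume h: "\<forall>x\<in>W. h x \<in> W" and z: "z \<in> W"
  define next_pt where
    "next_pt Y = (SOME t. t \<in> W \<and> z < t \<and> (\<forall>y\<in>Y. y < t \<and> (\<forall>x\<le>y. h x < t)))" for Y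
  have next_pt: "next_pt Y \<in> W \<and> z < next_pt Y \<and> (\<forall>y\<in>Y. y < next_pt Y \<and> (\<forall>x\<le>y. h x < next_pt Y))"
    if Y: "Y \<subseteq> W" "le_K Y" for Y
  proof -
    let ?U = "insert z (Y \<union> (\<Union>y\<in>Y. h ` {..y}))"
    have "h x \<in> W" if "y \<in> Y" "x \<le> y" for x y
      using that Y(1) h W_down_le by blast
    then have "?U \<subseteq> W"
      using Y(1) z by auto
    moreover have "le_K ?U"
    proof -
      have "le_K {z}"
        by (simp add: finite_small small_le_K)
      then have "le_K ({z} \<union> (Y \<union> (\<Union>y\<in>Y. h ` {..y})))"
        using Y W_atMost by (intro le_K_Un le_K_UN le_K_image) auto
      then show ?thesis
        by simp
    qed
    ultimately obtain t where "t \<in> W" "\<forall>x\<in>?U. x < t"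
      using W_bounded by meson
    then have "\<exists>t. t \<in> W \<and> z < t \<and> (\<forall>y\<in>Y. y < t \<and> (\<forall>x\<le>y. h x < t))"
      by (intro exI[of _ t]) auto
    then show ?thesis
      unfolding next_pt_def by (rule someI_ex)
  qed
  \<comment> \<open>One recursion clause covers successor and limit stages, as
    \<open>next_pt\<close> looks at all earlier points. The indices of interest are those in
    \<open>K\<close>.\<close>
  define s :: "'b \<Rightarrow> 'b" where "s = wfrec {(x, y). x < y} (\<lambda>s i. next_pt (s ` {..<i}))"
  have s_rec: "s i = next_pt (s ` {..<i})" for i
    unfolding s_def by (subst wfrec) (auto simp: wf cut_def intro!: arg_cong[of _ _ next_pt] image_cong)
  have sW: "s i \<in> W" if "i \<in> W" for i
    using that
  proof (induction i rule: less_induct)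
    case (less i)
    then show ?case
      using next_pt[of "s ` {..<i}"] W_segment[of i] W_down le_K_image[of "{..<i}" s]
      by (auto simp: s_rec[of i] le_K_def)
  qed
  have s: "z < s i" "\<And>j. j < i \<Longrightarrow> s j < s i" "\<And>j x. j < i \<Longrightarrow> x \<le> s j \<Longrightarrow> h x < s i" if "i \<in> W" for i
  proof -
    have "s ` {..<i} \<subseteq> W" "le_K (s ` {..<i})"
      using sW W_down that W_segment[of i] le_K_image[of "{..<i}" s] by (auto simp: le_K_def)
    from next_pt[OF this] show "z < s i" "\<And>j. j < i \<Longrightarrow> s j < s i" "\<And>j x. j < i \<Longrightarrow> x \<le> s j \<Longrightarrow> h x < s i"
      unfolding s_rec[of i] by auto
  qed
  have "s ` K \<subseteq> W" "le_K (s ` K)"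
    using sW K_subset le_K_image[OF le_K_refl] by auto
  then obtain t where "t \<in> W" "\<forall>x\<in>s ` K. x < t"
    using W_bounded by meson
  then have ex: "t \<in> W \<and> (\<forall>i\<in>K. s i < t)"
    by blast
  \<comment> \<open>The supremum of the sequence; it is not attained, since \<open>s\<close> is
    strictly increasing on \<open>K\<close> and \<open>K\<close> has no maximum.\<close>
  define g where "g = (LEAST t. t \<in> W \<and> (\<forall>i\<in>K. s i < t))"
  have g: "g \<in> W" "\<And>i. i \<in> K \<Longrightarrow> s i < g"
    using LeastI[of "\<lambda>t. t \<in> W \<and> (\<forall>i\<in>K. s i < t)", OF ex] unfolding g_def by auto
  have below: "\<exists>i\<in>K. x < s i" if xg: "x < g" for x
  proof -
    have "\<not> (x \<in> W \<and> (\<forall>i\<in>K. s i < x))"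
      using not_less_Least xg unfolding g_def by blast
    then obtain i where i: "i \<in> K" "x \<le> s i"
      using W_down[OF g(1) xg] by (auto simp: not_less)
    obtain j where "j \<in> K" "i < j"
      using K_above[OF i(1)] by blast
    then show ?thesis
      using s(2)[of j i] i K_subset by (intro bexI[of _ j]) auto
  qed
  have "g \<in> S"
    unfolding S_def
  proof (intro CollectI conjI allI impI g(1))
    fix X assume X: "X \<subseteq> {..<g} \<and> small X"
    then have "\<forall>x\<in>X. \<exists>i. i \<in> K \<and> x < s i"
      using below by blast
    then obtain i where i: "\<And>x. x \<in> X \<Longrightarrow> i x \<in> K" "\<And>x. x \<in> X \<Longrightarrow> x < s (i x)"
      by metis
    obtain j where j: "j \<in> K" "\<forall>k\<in>i ` X. k < j"
      using K_bounded[of "i ` X"] i(1) X small_image by blast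
    have "x < s j" if "x \<in> X" for x
      using i(2)[OF that] s(2)[of j "i x"] j that K_subset by fastforce
    then show "\<exists>\<xi><g. \<forall>x\<in>X. x < \<xi>"
      using g(2)[OF j(1)] by blast
  qed
  moreover have "z < g"
  proof -
    obtain i where "i \<in> K"
      using K_infinite by fastforce
    then show ?thesis
      using g(2)[of i] s(1)[of i] K_subset by (meson less_trans subsetD)
  qed
  moreover have "h x < g" if x: "x < g" for x
  proof -
    obtain i where i: "i \<in> K" "x < s i"
      using below[OF x] by blast
    obtain j where "j \<in> K" "i < j"
      using K_above[OF i(1)] by blast
    then show ?thesis
      using s(3)[of j i x] g(2)[of j] i K_subset by (meson less_imp_le less_trans subsetD)
  qed
  ultimately show "\<exists>g\<in>S. z < g \<and> (\<forall>x<g. h x < g)"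
    by blast
qed

text \<open>This is Ulam's argument. For each \<open>\<xi>\<close> the map sending
  \<open>\<delta>\<close> to \<open>E \<delta> \<xi>\<close> is constant on a stationary set;
  kappa^+ many \<open>\<xi>\<close> share the constant value \<open>\<mu>\<close>, and injectivity
  of \<open>E \<delta>\<close> makes their stationary sets disjoint.\<close>

lemma S_split: "\<exists>\<pi>. \<forall>\<gamma>\<in>W. stationary {\<delta> \<in> S. \<pi> \<delta> = \<gamma>}"
proof -
  have "\<exists>\<nu>\<in>K. stationary {\<delta> \<in> S. \<xi> < \<delta> \<and> E \<delta> \<xi> = \<nu>}" if "\<xi> \<in> W" for \<xi>
  proof -
    have "stationary {\<delta> \<in> S. \<xi> < \<delta>}"
      by (rule stationary_mono[OF stationary_closed[OF stationary_S, of "\<lambda>x. x" \<xi>]]) (use that S_W in auto)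
    then obtain \<nu> where "\<nu> \<in> K" "stationary {\<delta> \<in> {\<delta> \<in> S. \<xi> < \<delta>}. E \<delta> \<xi> = \<nu>}"
      using fodor_le_K[of "{\<delta> \<in> S. \<xi> < \<delta>}" K "\<lambda>\<delta>. E \<delta> \<xi>"] le_K_refl E_K S_W by auto
    then show ?thesis
      by (intro bexI[of _ \<nu>]) (simp_all add: conj_assoc)
  qed
  then obtain \<nu> where \<nu>: "\<And>\<xi>. \<xi> \<in> W \<Longrightarrow> \<nu> \<xi> \<in> K"
      "\<And>\<xi>. \<xi> \<in> W \<Longrightarrow> stationary {\<delta> \<in> S. \<xi> < \<delta> \<and> E \<delta> \<xi> = \<nu> \<xi>}"
    by metis
  obtain \<mu> where \<mu>: "\<mu> \<in> K" "unbounded {\<xi> \<in> W. \<nu> \<xi> = \<mu>}"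
    using unbounded_pigeonhole[OF unbounded_W le_K_refl, of \<nu>] \<nu>(1) by blast
  have "W \<noteq> {}"
    using K_subset K_infinite by auto
  \<comment> \<open>The surviving \<open>\<xi>\<close> are kappa^+ many, so \<open>q\<close> can
    relabel them by all of \<open>W\<close>.\<close>
  then obtain q where q: "q ` {\<xi> \<in> W. \<nu> \<xi> = \<mu>} = W"
    using card_of_ordLeq2[THEN iffD2, OF _ unbounded_card[OF \<mu>(2)]] by blast
  define \<pi> where "\<pi> \<delta> = q (THE \<xi>. \<xi> < \<delta> \<and> E \<delta> \<xi> = \<mu>)" for \<delta>
  have "stationary {\<delta> \<in> S. \<pi> \<delta> = \<gamma>}" if "\<gamma> \<in> W" for \<gamma>
  proof -
    have "\<gamma> \<in> q ` {\<xi> \<in> W. \<nu> \<xi> = \<mu>}"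
      using q that by simp
    then obtain \<xi> where \<xi>: "\<xi> \<in> W" "\<nu> \<xi> = \<mu>" "q \<xi> = \<gamma>"
      by blast
    have "\<pi> \<delta> = \<gamma>" if "\<delta> \<in> S" "\<xi> < \<delta>" "E \<delta> \<xi> = \<mu>" for \<delta>
    proof -
      have "(THE \<xi>. \<xi> < \<delta> \<and> E \<delta> \<xi> = \<mu>) = \<xi>"
        using that E_inj[OF S_W[OF that(1)]] by (intro the_equality) (auto dest: inj_onD)
      then show ?thesis
        by (simp add: \<pi>_def \<xi>)
    qed
    then show ?thesis
      using \<nu>(2)[OF \<xi>(1)] \<xi>(2) S_W by (elim stationary_mono) auto
  qed
  then show ?thesis
    by blast
qed

section \<open>Walks and oscillations\<close>

text \<open>The supremum of the part of \<open>C \<beta>\<close> below \<open>\<alpha>\<close>, and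
  the least ordinal if that part is empty. It stays below \<open>\<alpha>\<close> when
  \<open>\<alpha>\<close> has cofinality kappa.\<close>

definition cut_sup :: "'b \<Rightarrow> 'b \<Rightarrow> 'b" where
  "cut_sup \<alpha> \<beta> = (LEAST \<eta>. \<forall>x. x \<in> C \<beta> \<and> x < \<alpha> \<longrightarrow> x \<le> \<eta>)"

lemma cut_sup_le: "cut_sup \<alpha> \<beta> \<le> \<alpha>"
  unfolding cut_sup_def by (rule Least_le) auto

lemma cut_sup_ge: "c \<in> C \<beta> \<Longrightarrow> c < \<alpha> \<Longrightarrow> c \<le> cut_sup \<alpha> \<beta>"
proof -
  have "\<forall>x. x \<in> C \<beta> \<and> x < \<alpha> \<longrightarrow> x \<le> cut_sup \<alpha> \<beta>"
    unfolding cut_sup_def by (rule LeastI[of _ \<alpha>]) auto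
  then show "c \<in> C \<beta> \<Longrightarrow> c < \<alpha> \<Longrightarrow> c \<le> cut_sup \<alpha> \<beta>"
    by blast
qed

lemma cut_sup_less:
  assumes "\<delta> \<in> S" "\<beta> \<in> W" "\<delta> < \<beta>"
  shows "cut_sup \<delta> \<beta> < \<delta>"
proof -
  obtain \<xi> where "\<xi> < \<delta>" "\<forall>x\<in>{x \<in> C \<beta>. x < \<delta>}. x < \<xi>"
    using S_bounded[OF assms(1) C_small[OF assms(2,3)]] by blast
  then have "cut_sup \<delta> \<beta> \<le> \<xi>"
    unfolding cut_sup_def by (intro Least_le) auto
  then show ?thesis
    using \<open>\<xi> < \<delta>\<close> by simp
qed

text \<open>No point of \<open>C \<beta>\<close> lies in the interval from \<open>\<alpha>\<close>
  up to \<open>\<delta>\<close>, so \<open>C \<beta>\<close> is cut at the same place by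
  both.\<close>

lemma same_step:
  assumes "\<alpha> < \<delta>" "cut_sup \<delta> \<beta> < \<alpha>"
  shows "next_step \<alpha> \<beta> = next_step \<delta> \<beta>" "cut_sup \<alpha> \<beta> = cut_sup \<delta> \<beta>"
proof -
  have gap: "c < \<alpha> \<longleftrightarrow> c < \<delta>" if "c \<in> C \<beta>" for c
    using cut_sup_ge[OF that, of \<delta>] assms by auto
  then have "(\<lambda>c. c \<in> C \<beta> \<and> \<alpha> \<le> c) = (\<lambda>c. c \<in> C \<beta> \<and> \<delta> \<le> c)"
    by (auto simp: fun_eq_iff not_less[symmetric])
  then show "next_step \<alpha> \<beta> = next_step \<delta> \<beta>"
    unfolding next_step_def by simp
  have "(\<lambda>x. x \<in> C \<beta> \<and> x < \<alpha>) = (\<lambda>x. x \<in> C \<beta> \<and> x < \<delta>)"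
    using gap by auto
  then show "cut_sup \<alpha> \<beta> = cut_sup \<delta> \<beta>"
    unfolding cut_sup_def by metis
qed

text \<open>The lower trace of the walk from \<open>\<beta>\<close> to \<open>\<alpha>\<close>, as a list in the order of the walk; taking
  running maxima makes it nondecreasing.\<close>

definition L :: "'b \<Rightarrow> 'b \<Rightarrow> 'b list" where
  "L \<alpha> = wfrec {(x, y). x < y} (\<lambda>f \<beta>.
     if \<beta> \<in> W \<and> \<alpha> < \<beta> then cut_sup \<alpha> \<beta> # map (max (cut_sup \<alpha> \<beta>)) (f (next_step \<alpha> \<beta>)) else [])"

lemma L_rec: "L \<alpha> \<beta> = (if \<beta> \<in> W \<and> \<alpha> < \<beta> then cut_sup \<alpha> \<beta> # map (max (cut_sup \<alpha> \<beta>)) (L \<alpha> (next_step \<alpha> \<beta>)) else [])"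
  by (subst def_wfrec[OF L_def[THEN eq_reflection] wf]) (auto simp: cut_def next_step_less)

lemma L_less: "\<beta> \<in> W \<Longrightarrow> \<alpha> < \<beta> \<Longrightarrow> L \<alpha> \<beta> = cut_sup \<alpha> \<beta> # map (max (cut_sup \<alpha> \<beta>)) (L \<alpha> (next_step \<alpha> \<beta>))"
  by (subst L_rec) simp

lemma L_refl: "L \<alpha> \<alpha> = []"
  by (subst L_rec) simp

text \<open>Through the running maxima every entry is at least the first one,
  \<open>cut_sup \<alpha> \<beta>\<close>.\<close>

lemma L_ge:
  assumes "c \<in> C \<beta>" "c < \<alpha>" "\<alpha> < \<beta>" "\<beta> \<in> W" "x \<in> set (L \<alpha> \<beta>)"
  shows "c \<le> x"
  using assms(5) cut_sup_ge[OF assms(1,2)] unfolding L_less[OF assms(4,3)] by (auto simp: le_max_iff_disj)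

lemma L_le: "x \<in> set (L \<alpha> \<beta>) \<Longrightarrow> x \<le> \<alpha>"
proof (induction \<beta> arbitrary: x rule: less_induct)
  case (less \<beta>)
  then have "\<beta> \<in> W" "\<alpha> < \<beta>"
    using L_rec[of \<alpha> \<beta>] by (auto split: if_splits)
  then show ?case
    using less.prems less.IH[OF next_step_less] cut_sup_le by (auto simp: L_less)
qed

lemma L_less_S: "\<delta> \<in> S \<Longrightarrow> x \<in> set (L \<delta> \<beta>) \<Longrightarrow> x < \<delta>"
proof (induction \<beta> arbitrary: x rule: less_induct)
  case (less \<beta>)
  then have "\<beta> \<in> W" "\<delta> < \<beta>"
    using L_rec[of \<delta> \<beta>] by (auto split: if_splits)
  then show ?case
    using less.prems less.IH[OF next_step_less] cut_sup_less by (auto simp: L_less)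
qed

section \<open>Walks that pass through a given ordinal\<close>

fun walk :: "'b \<Rightarrow> 'b \<Rightarrow> nat \<Rightarrow> 'b" where
  "walk \<alpha> \<beta> 0 = \<beta>"
| "walk \<alpha> \<beta> (Suc n) = walk \<alpha> (next_step \<alpha> \<beta>) n"

text \<open>While \<open>\<alpha>\<close> exceeds all entries of \<open>L \<delta> \<beta>\<close>,
  the steps towards \<open>\<alpha>\<close> and towards \<open>\<delta>\<close> agree by
  \<open>same_step\<close>, until \<open>\<delta>\<close> is reached. The premise of the second
  conjunct keeps the running maxima from changing the part
  \<open>L \<alpha> \<delta>\<close>.\<close>

lemma walk_through:
  assumes "\<beta> \<in> W" "\<alpha> < \<delta>" "\<delta> \<le> \<beta>" "\<And>x. x \<in> set (L \<delta> \<beta>) \<Longrightarrow> x < \<alpha>"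
  shows "walk \<alpha> \<beta> (length (L \<delta> \<beta>)) = \<delta> \<and>
    ((\<forall>x\<in>set (L \<delta> \<beta>). \<forall>y\<in>set (L \<alpha> \<delta>). x \<le> y) \<longrightarrow> L \<alpha> \<beta> = L \<delta> \<beta> @ L \<alpha> \<delta>)"
  using assms
proof (induction \<beta> rule: less_induct)
  case (less \<beta>)
  show ?case
  proof (cases "\<delta> = \<beta>")
    case False
    then have lt: "\<delta> < \<beta>" "\<alpha> < \<beta>"
      using less.prems by auto
    let ?s = "cut_sup \<delta> \<beta>" and ?c = "next_step \<delta> \<beta>"
    have Ld: "L \<delta> \<beta> = ?s # map (max ?s) (L \<delta> ?c)"
      using L_less less.prems(1) lt by blast
    have s: "?s < \<alpha>"
      using less.prems(4) Ld by simp
    note same = same_step[OF less.prems(2) s]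
    have La: "L \<alpha> \<beta> = ?s # map (max ?s) (L \<alpha> ?c)"
      using L_less[OF less.prems(1) lt(2)] same by simp
    have c: "?c < \<beta>" "?c \<in> W" "\<delta> \<le> ?c"
      using next_step_less next_step_W next_step_ge less.prems(1) lt(1) by blast+
    have small: "x < \<alpha>" if "x \<in> set (L \<delta> ?c)" for x
      using less.prems(4)[of "max ?s x"] that Ld by simp
    have "walk \<alpha> \<beta> (length (L \<delta> \<beta>)) = \<delta>"
      using less.IH[OF c(1,2) less.prems(2) c(3) small] same Ld by simp
    moreover have "L \<alpha> \<beta> = L \<delta> \<beta> @ L \<alpha> \<delta>" if le: "\<forall>x\<in>set (L \<delta> \<beta>). \<forall>y\<in>set (L \<alpha> \<delta>). x \<le> y"
    proof -
      have "x \<le> y" if "x \<in> set (L \<delta> ?c)" "y \<in> set (L \<alpha> \<delta>)" for x y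
        using le that Ld by auto
      then have "L \<alpha> ?c = L \<delta> ?c @ L \<alpha> \<delta>"
        using less.IH[OF c(1,2) less.prems(2) c(3) small] by blast
      moreover have "?s \<le> y" if "y \<in> set (L \<alpha> \<delta>)" for y
        using le that unfolding Ld by simp
      then have "map (max ?s) (L \<alpha> \<delta>) = L \<alpha> \<delta>"
        by (intro map_idI) (simp add: max_absorb2)
      ultimately show ?thesis
        using La Ld by simp
    qed
    ultimately show ?thesis
      by blast
  qed (simp add: L_refl)
qed

text \<open>The point \<open>c\<close> separates the two traces: entries of
  \<open>L \<delta> \<beta>\<close> lie at or below it, those of \<open>L \<alpha> \<delta>\<close>
  at or above it by \<open>L_ge\<close>.\<close>

lemma L_append:
  assumes "\<beta> \<in> W" "\<alpha> < \<delta>" "\<delta> \<le> \<beta>" "c \<in> C \<delta>" "c < \<alpha>" "\<And>x. x \<in> set (L \<delta> \<beta>) \<Longrightarrow> x \<le> c"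
  shows "L \<alpha> \<beta> = L \<delta> \<beta> @ L \<alpha> \<delta>"
proof -
  have "x < \<alpha>" if "x \<in> set (L \<delta> \<beta>)" for x
    using assms(5) assms(6)[OF that] by simp
  moreover have "\<delta> \<in> W"
    using W_down_le assms(1,3) by blast
  then have "x \<le> y" if "x \<in> set (L \<delta> \<beta>)" "y \<in> set (L \<alpha> \<delta>)" for x y
    using assms(6)[OF that(1)] L_ge[OF assms(4,5,2) _ that(2)] by simp
  ultimately show ?thesis
    using walk_through[OF assms(1-3)] by blast
qed

section \<open>Oscillations and types of pairs\<close>

definition osc :: "'b \<Rightarrow> 'b \<Rightarrow> nat" where
  "osc \<alpha> \<beta> = rises (map (\<lambda>\<xi>. e \<xi> \<beta> < e \<xi> \<alpha>) (L \<alpha> \<beta>))"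

text \<open>The information on \<open>\<alpha>\<close> and \<open>\<beta>\<close> visible along the
  trace down to \<open>\<gamma>\<close>. For \<open>\<gamma>\<close> in \<open>S\<close> it is a
  finite list with first coordinates below \<open>\<gamma>\<close>, hence can be pressed down; for
  \<open>\<gamma> = \<alpha>\<close> its signs determine
  \<open>osc \<alpha> \<beta>\<close>.\<close>

definition tp :: "'b \<Rightarrow> 'b \<Rightarrow> 'b \<Rightarrow> ('b \<times> 'b \<times> 'b) list" where
  "tp \<alpha> \<beta> \<gamma> = map (\<lambda>\<xi>. (\<xi>, e \<xi> \<alpha>, e \<xi> \<beta>)) (L \<gamma> \<beta>)"

lemma e_eventually_equal:
  assumes "\<gamma> \<in> S" "\<gamma> < \<alpha>" "\<alpha> \<in> W"
  shows "\<exists>\<eta><\<gamma>. \<forall>\<xi>. \<eta> \<le> \<xi> \<and> \<xi> < \<gamma> \<longrightarrow> e \<xi> \<gamma> = e \<xi> \<alpha>"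
proof -
  obtain \<eta> where "\<eta> < \<gamma>" "\<forall>\<xi>\<in>{\<xi>. \<xi> < \<gamma> \<and> e \<xi> \<gamma> \<noteq> e \<xi> \<alpha>}. \<xi> < \<eta>"
    using S_bounded[OF assms(1) e_coherent[OF assms(3,2)]] by blast
  then show ?thesis
    by (intro exI[of _ \<eta>]) force
qed

end

definition signs :: "('b::wellorder \<times> 'b \<times> 'b) list \<Rightarrow> bool list" where
  "signs = map (\<lambda>(\<xi>, x, y). y < x)"

lemma signs_simps [simp]: "signs (l @ l') = signs l @ signs l'" "signs l = [] \<longleftrightarrow> l = []"
  by (simp_all add: signs_def)

text \<open>\<open>A\<close> is the set of first coordinates of a rectangle. The second coordinates \<open>\<beta>\<close> come together
  with ordinals \<open>\<delta> \<le> \<beta>\<close>, so that one can ask for pairs with \<open>\<alpha> < \<delta>\<close>.\<close>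

locale rectangle = succ_card W K for W K :: "'b::wellorder set" +
  fixes A :: "'b set" and D :: "('b \<times> 'b) set"
  assumes A_unbounded: "unbounded A"
    and D_W: "(\<delta>, \<beta>) \<in> D \<Longrightarrow> \<beta> \<in> W"
    and D_le: "(\<delta>, \<beta>) \<in> D \<Longrightarrow> \<delta> \<le> \<beta>"
    and D_unbounded: "z \<in> W \<Longrightarrow> \<exists>\<delta> \<beta>. (\<delta>, \<beta>) \<in> D \<and> z < \<delta>"
begin

text \<open>\<open>\<alpha>\<close> and \<open>\<beta>\<close> are each required to lie above
  \<open>\<gamma>\<close> but are not compared with each other, which leaves room to recombine
  coordinates coming from different pairs.\<close>

definition T :: "('b \<times> 'b \<times> 'b) list \<Rightarrow> 'b set" where
  "T l = {\<gamma> \<in> S. \<exists>\<alpha>\<in>A. \<exists>\<delta> \<beta>. (\<delta>, \<beta>) \<in> D \<and> \<gamma> < \<alpha> \<and> \<gamma> < \<delta> \<and> tp \<alpha> \<beta> \<gamma> = l}"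

lemma T_S: "\<gamma> \<in> T l \<Longrightarrow> \<gamma> \<in> S"
  by (simp add: T_def)

lemma T_I: "\<gamma> \<in> S \<Longrightarrow> \<alpha> \<in> A \<Longrightarrow> (\<delta>, \<beta>) \<in> D \<Longrightarrow> \<gamma> < \<alpha> \<Longrightarrow> \<gamma> < \<delta> \<Longrightarrow> tp \<alpha> \<beta> \<gamma> = l \<Longrightarrow> \<gamma> \<in> T l"
  unfolding T_def by blast

lemma T_E:
  assumes "\<gamma> \<in> T l"
  obtains \<alpha> \<delta> \<beta> where "\<alpha> \<in> A" "(\<delta>, \<beta>) \<in> D" "\<gamma> < \<alpha>" "\<gamma> < \<delta>" "\<gamma> < \<beta>" "tp \<alpha> \<beta> \<gamma> = l" "\<alpha> \<in> W" "\<beta> \<in> W"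
proof -
  obtain \<alpha> \<delta> \<beta> where *: "\<alpha> \<in> A" "(\<delta>, \<beta>) \<in> D" "\<gamma> < \<alpha>" "\<gamma> < \<delta>" "tp \<alpha> \<beta> \<gamma> = l"
    using assms unfolding T_def by blast
  moreover have "\<gamma> < \<beta>" "\<beta> \<in> W" "\<alpha> \<in> W"
    using D_le[OF *(2)] D_W[OF *(2)] *(1,4) A_unbounded unfolding unbounded_def by auto
  ultimately show thesis
    using that by blast
qed

lemma T_elem:
  assumes "\<gamma> \<in> T l" "(\<xi>, x, y) \<in> set l"
  shows "\<xi> < \<gamma>" "x \<in> K" "y \<in> K"
proof -
  obtain \<alpha> \<beta> where "tp \<alpha> \<beta> \<gamma> = l"
    using T_E[OF assms(1)] by metis
  then show "\<xi> < \<gamma>" "x \<in> K" "y \<in> K"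
    using assms L_less_S[OF T_S[OF assms(1)]] e_K by (auto simp: tp_def)
qed

text \<open>Beyond some point below \<open>\<gamma>\<close>, both \<open>\<alpha>\<close> and
  \<open>\<beta>\<close> agree with \<open>\<gamma>\<close> in their \<open>e\<close>-values. A
  member \<open>c\<close> of \<open>C \<gamma>\<close> past that point and past the entries of
  \<open>l\<close> is then made constant by pressing down.\<close>

lemma uniformize:
  assumes "stationary Z" "Z \<subseteq> T l"
  obtains Y c \<alpha> \<delta> \<beta> where "stationary Y" "Y \<subseteq> Z"
    and "\<And>\<gamma>. \<gamma> \<in> Y \<Longrightarrow> c \<in> C \<gamma> \<and> \<alpha> \<gamma> \<in> A \<and> (\<delta> \<gamma>, \<beta> \<gamma>) \<in> D \<and> \<gamma> < \<alpha> \<gamma> \<and> \<gamma> < \<delta> \<gamma> \<and> \<gamma> < \<beta> \<gamma> \<and> \<alpha> \<gamma> \<in> W \<and> \<beta> \<gamma> \<in> W"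
    and "\<And>\<gamma>. \<gamma> \<in> Y \<Longrightarrow> tp (\<alpha> \<gamma>) (\<beta> \<gamma>) \<gamma> = l"
    and "\<And>\<gamma> \<xi>. \<gamma> \<in> Y \<Longrightarrow> c \<le> \<xi> \<Longrightarrow> \<xi> < \<gamma> \<Longrightarrow> e \<xi> (\<alpha> \<gamma>) = e \<xi> (\<beta> \<gamma>)"
    and "\<And>\<xi> x y. (\<xi>, x, y) \<in> set l \<Longrightarrow> \<xi> \<le> c"
proof -
  define G where "G \<gamma> \<alpha> \<delta> \<beta> c \<longleftrightarrow> c \<in> C \<gamma> \<and> \<alpha> \<in> A \<and> (\<delta>, \<beta>) \<in> D \<and> \<gamma> < \<alpha> \<and> \<gamma> < \<delta> \<and> \<gamma> < \<beta> \<and> \<alpha> \<in> W \<and> \<beta> \<in> W \<and>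
      tp \<alpha> \<beta> \<gamma> = l \<and> (\<forall>\<xi>. c \<le> \<xi> \<and> \<xi> < \<gamma> \<longrightarrow> e \<xi> \<alpha> = e \<xi> \<beta>) \<and> (\<forall>t\<in>set l. fst t \<le> c)" for \<gamma> \<alpha> \<delta> \<beta> c
  have "\<exists>\<alpha> \<delta> \<beta> c. G \<gamma> \<alpha> \<delta> \<beta> c" if "\<gamma> \<in> Z" for \<gamma>
  proof -
    have "\<gamma> \<in> T l"
      using that assms(2) by blast
    then obtain \<alpha> \<delta> \<beta> where *: "\<alpha> \<in> A" "(\<delta>, \<beta>) \<in> D" "\<gamma> < \<alpha>" "\<gamma> < \<delta>" "\<gamma> < \<beta>" "tp \<alpha> \<beta> \<gamma> = l" "\<alpha> \<in> W" "\<beta> \<in> W"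
      by (rule T_E)
    have "\<gamma> \<in> S"
      using \<open>\<gamma> \<in> T l\<close> by (rule T_S)
    obtain \<eta> where \<eta>: "\<eta> < \<gamma>" "\<forall>\<xi>. \<eta> \<le> \<xi> \<and> \<xi> < \<gamma> \<longrightarrow> e \<xi> \<gamma> = e \<xi> \<alpha>"
      using e_eventually_equal[OF \<open>\<gamma> \<in> S\<close> *(3,7)] by blast
    obtain \<eta>' where \<eta>': "\<eta>' < \<gamma>" "\<forall>\<xi>. \<eta>' \<le> \<xi> \<and> \<xi> < \<gamma> \<longrightarrow> e \<xi> \<gamma> = e \<xi> \<beta>"
      using e_eventually_equal[OF \<open>\<gamma> \<in> S\<close> *(5,8)] by blast
    have "x < \<gamma>" if "x \<in> insert \<eta> (insert \<eta>' (fst ` set l))" for x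
      using T_elem(1)[OF \<open>\<gamma> \<in> T l\<close>] that \<eta>(1) \<eta>'(1) by auto
    then obtain \<zeta> where \<zeta>: "\<zeta> < \<gamma>" "\<forall>x\<in>insert \<eta> (insert \<eta>' (fst ` set l)). x < \<zeta>"
      using S_finite_bounded[OF \<open>\<gamma> \<in> S\<close>, of "insert \<eta> (insert \<eta>' (fst ` set l))"] by blast
    obtain c where c: "c \<in> C \<gamma>" "\<zeta> \<le> c"
      using C_cofinal[OF S_W[OF \<open>\<gamma> \<in> S\<close>] \<zeta>(1)] by blast
    have "e \<xi> \<alpha> = e \<xi> \<beta>" if "c \<le> \<xi>" "\<xi> < \<gamma>" for \<xi>
    proof -
      have "\<eta> \<le> \<xi>" "\<eta>' \<le> \<xi>"
        using \<zeta> c that by auto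
      then show ?thesis
        using \<eta>(2) \<eta>'(2) that by metis
    qed
    moreover have "\<forall>t\<in>set l. fst t \<le> c"
      using \<zeta> c by fastforce
    ultimately show ?thesis
      using * c(1) unfolding G_def by blast
  qed
  then obtain \<alpha> \<delta> \<beta> c where G: "\<And>\<gamma>. \<gamma> \<in> Z \<Longrightarrow> G \<gamma> (\<alpha> \<gamma>) (\<delta> \<gamma>) (\<beta> \<gamma>) (c \<gamma>)"
    by metis
  have "\<exists>z<\<gamma>. c \<gamma> \<in> {..z}" if "\<gamma> \<in> Z" for \<gamma>
    using G[OF that] C_less unfolding G_def by (intro exI[of _ "c \<gamma>"]) auto
  then obtain d where d: "stationary {\<gamma> \<in> Z. c \<gamma> = d}"
    using fodor[OF assms(1), of atMost c] W_atMost by auto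
  obtain z where "z \<in> W"
    using K_subset K_infinite by fastforce
  then obtain g where "g \<in> Z" "c g = d"
    using stationaryD[OF d, of "\<lambda>x. x" z] by auto
  show thesis
  proof (rule that[OF d, of d \<alpha> \<delta> \<beta>])
    show "\<xi> \<le> d" if "(\<xi>, x, y) \<in> set l" for \<xi> x y
      using G[OF \<open>g \<in> Z\<close>] \<open>c g = d\<close> that unfolding G_def by fastforce
  qed (use G in \<open>auto simp: G_def\<close>)
qed

text \<open>The trace splits at \<open>\<theta>\<close> by \<open>L_append\<close>. The first
  coordinate may be exchanged for any \<open>\<alpha>\<close> with the \<open>e\<close>-values
  recorded in \<open>l\<close>.\<close>

lemma tp_extend:
  assumes "\<gamma> < \<theta>" "\<theta> < \<beta>" "\<beta> \<in> W" "c \<in> C \<theta>" "c < \<gamma>" "tp \<alpha>' \<beta> \<theta> = l"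
    and "\<And>\<xi> x y. (\<xi>, x, y) \<in> set l \<Longrightarrow> \<xi> \<le> c"
    and "\<And>\<xi> x y. (\<xi>, x, y) \<in> set l \<Longrightarrow> e \<xi> \<alpha> = x"
  shows "tp \<alpha> \<beta> \<gamma> = l @ map (\<lambda>\<xi>. (\<xi>, e \<xi> \<alpha>, e \<xi> \<beta>)) (L \<gamma> \<theta>)"
proof -
  have "x \<le> c" if "x \<in> set (L \<theta> \<beta>)" for x
  proof -
    have "(x, e x \<alpha>', e x \<beta>) \<in> set l"
      using that unfolding assms(6)[symmetric] tp_def by auto
    then show ?thesis
      by (rule assms(7))
  qed
  then have "L \<gamma> \<beta> = L \<theta> \<beta> @ L \<gamma> \<theta>"
    using assms by (intro L_append[of _ _ _ c]) auto
  moreover have "map (\<lambda>\<xi>. (\<xi>, e \<xi> \<alpha>, e \<xi> \<beta>)) (L \<theta> \<beta>) = l"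
    using assms(8) unfolding assms(6)[symmetric] tp_def by (intro map_cong) auto
  ultimately show ?thesis
    by (simp add: tp_def)
qed

section \<open>Extending types by blocks of constant sign\<close>

lemma tp_e: "tp \<alpha> \<beta> \<gamma> = l \<Longrightarrow> (\<xi>, x, y) \<in> set l \<Longrightarrow> e \<xi> \<alpha> = x \<and> e \<xi> \<beta> = y"
  by (auto simp: tp_def)

lemma L_nonempty: "\<gamma> < \<theta> \<Longrightarrow> \<theta> \<in> W \<Longrightarrow> L \<gamma> \<theta> \<noteq> []"
  by (simp add: L_less)

text \<open>The new block is the trace from a point \<open>\<theta>\<close> of \<open>Y\<close> down
  to a smaller \<open>\<gamma>\<close>. Its sign is controlled by choosing the point
  \<open>\<sigma>\<close> from which the first coordinate is taken:
  \<open>\<sigma> = \<theta>\<close> yields equal \<open>e\<close>-values, a suitable other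
  \<open>\<sigma>\<close> yields larger ones.\<close>

lemma extension_exists:
  assumes "stationary Z" "Z \<subseteq> T l"
  shows "\<exists>\<gamma>\<in>Z. \<exists>l'. set (signs l') = {b} \<and> \<gamma> \<in> T (l @ l')"
proof -
  obtain Y c \<alpha> \<delta> \<beta> where Y: "stationary Y" "Y \<subseteq> Z"
    and G: "\<And>\<gamma>. \<gamma> \<in> Y \<Longrightarrow> c \<in> C \<gamma> \<and> \<alpha> \<gamma> \<in> A \<and> (\<delta> \<gamma>, \<beta> \<gamma>) \<in> D \<and> \<gamma> < \<alpha> \<gamma> \<and> \<gamma> < \<delta> \<gamma> \<and> \<gamma> < \<beta> \<gamma> \<and> \<alpha> \<gamma> \<in> W \<and> \<beta> \<gamma> \<in> W"
    and tp: "\<And>\<gamma>. \<gamma> \<in> Y \<Longrightarrow> tp (\<alpha> \<gamma>) (\<beta> \<gamma>) \<gamma> = l"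
    and eq: "\<And>\<gamma> \<xi>. \<gamma> \<in> Y \<Longrightarrow> c \<le> \<xi> \<Longrightarrow> \<xi> < \<gamma> \<Longrightarrow> e \<xi> (\<alpha> \<gamma>) = e \<xi> (\<beta> \<gamma>)"
    and c: "\<And>\<xi> x y. (\<xi>, x, y) \<in> set l \<Longrightarrow> \<xi> \<le> c"
    using uniformize[OF assms] by blast
  have YS: "\<gamma> \<in> S" if "\<gamma> \<in> Y" for \<gamma>
    using that Y(2) assms(2) T_S by blast
  have cless: "c < \<gamma>" if "\<gamma> \<in> Y" for \<gamma>
    using G[OF that] C_less by blast
  \<comment> \<open>Coordinates from different points combine because both realize the same list
    \<open>l\<close> with the same \<open>c\<close>.\<close>
  have ext: "\<gamma> \<in> T (l @ map (\<lambda>\<xi>. (\<xi>, e \<xi> (\<alpha> \<sigma>), e \<xi> (\<beta> \<theta>))) (L \<gamma> \<theta>))"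
    if "\<gamma> \<in> Y" "\<theta> \<in> Y" "\<sigma> \<in> Y" "\<gamma> < \<theta>" "\<gamma> < \<alpha> \<sigma>" for \<gamma> \<theta> \<sigma>
  proof (rule T_I[of _ "\<alpha> \<sigma>" "\<delta> \<theta>" "\<beta> \<theta>"])
    have "e \<xi> (\<alpha> \<sigma>) = x" if "(\<xi>, x, y) \<in> set l" for \<xi> x y
      using tp_e[OF tp[OF \<open>\<sigma> \<in> Y\<close>] that] by blast
    then show "tp (\<alpha> \<sigma>) (\<beta> \<theta>) \<gamma> = l @ map (\<lambda>\<xi>. (\<xi>, e \<xi> (\<alpha> \<sigma>), e \<xi> (\<beta> \<theta>))) (L \<gamma> \<theta>)"
      using G[OF that(2)] that cless c by (intro tp_extend[OF that(4) _ _ _ _ tp[OF that(2)]]) auto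
  qed (use that YS G[of \<sigma>] G[of \<theta>] in auto)
  have Lne: "L \<gamma> \<theta> \<noteq> []" if "\<gamma> < \<theta>" "\<theta> \<in> Y" for \<gamma> \<theta>
    using L_nonempty[OF that(1)] S_W YS that(2) by blast
  show ?thesis
  proof (cases b)
    case False
    obtain z where "z \<in> W"
      using K_subset K_infinite by fastforce
    then obtain \<gamma> where \<gamma>: "\<gamma> \<in> Y"
      using stationary_unbounded[OF Y(1)] unfolding unbounded_def by blast
    then obtain \<theta> where \<theta>: "\<theta> \<in> Y" "\<gamma> < \<theta>"
      using stationary_unbounded[OF Y(1)] stationary_W[OF Y(1)] unfolding unbounded_def by blast
    let ?l = "map (\<lambda>\<xi>. (\<xi>, e \<xi> (\<alpha> \<theta>), e \<xi> (\<beta> \<theta>))) (L \<gamma> \<theta>)"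
    have "\<not> e \<xi> (\<beta> \<theta>) < e \<xi> (\<alpha> \<theta>)" if "\<xi> \<in> set (L \<gamma> \<theta>)" for \<xi>
    proof -
      have "c \<le> \<xi>"
        using L_ge[OF _ cless[OF \<gamma>] \<theta>(2) _ that] G[OF \<theta>(1)] YS S_W \<theta>(1) by blast
      moreover have "\<xi> < \<theta>"
        using L_le[OF that] \<theta>(2) by order
      ultimately show ?thesis
        using eq[OF \<theta>(1)] by simp
    qed
    then have "set (signs ?l) \<subseteq> {b}"
      using False by (auto simp: signs_def)
    moreover have "signs ?l \<noteq> []"
      using Lne[OF \<theta>(2,1)] by simp
    ultimately have "set (signs ?l) = {b}"
      by (rule set_constant_list)
    moreover have "\<gamma> < \<alpha> \<theta>"
      using G[OF \<theta>(1)] \<theta>(2) by auto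
    ultimately show ?thesis
      using ext[OF \<gamma> \<theta>(1) \<theta>(1) \<theta>(2)] \<gamma> Y(2) by blast
  next
    case True
    text \<open>For every \<open>\<eta>\<close> the trace \<open>L \<gamma> \<theta>\<close> can be placed above \<open>\<eta>\<close>, with \<open>e\<close>-values bounded by a fixed
      \<open>\<nu>\<close>; a point \<open>\<sigma>\<close> closed under this assignment sees \<open>e\<close>-values larger than \<open>\<nu>\<close> there.\<close>
    define H where "H \<eta> \<nu> \<gamma> \<theta> \<longleftrightarrow> \<gamma> \<in> Y \<and> \<theta> \<in> Y \<and> \<gamma> < \<theta> \<and> (\<forall>\<xi>\<in>set (L \<gamma> \<theta>). \<eta> < \<xi> \<and> e \<xi> (\<beta> \<theta>) \<le> \<nu>)"
      for \<eta> \<nu> \<gamma> \<theta>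
    have "\<exists>\<nu> \<gamma> \<theta>. \<nu> \<in> K \<and> H \<eta> \<nu> \<gamma> \<theta>" if \<eta>: "\<eta> \<in> W" for \<eta>
    proof -
      have "\<forall>x\<in>W. \<exists>y\<in>Y. x < y"
        using stationary_unbounded[OF Y(1)] unfolding unbounded_def by blast
      then obtain n where n: "\<And>x. x \<in> W \<Longrightarrow> n x \<in> Y" "\<And>x. x \<in> W \<Longrightarrow> x < n x"
        by metis
      \<comment> \<open>Closure under \<open>n\<close> makes \<open>Y\<close> cofinal in
        \<open>\<theta>\<close>, so a point of \<open>Y\<close> fits between a member
        \<open>c'\<close> of \<open>C \<theta>\<close> above \<open>\<eta>\<close> and
        \<open>\<theta>\<close>; \<open>c'\<close> then bounds the trace from below.\<close>
      obtain \<theta> where \<theta>: "\<theta> \<in> Y" "\<eta> < \<theta>" "\<And>x. x < \<theta> \<Longrightarrow> n x < \<theta>"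
        by (rule stationaryD[OF Y(1), of n \<eta>]) (use n stationary_W[OF Y(1)] \<eta> in auto)
      have \<theta>W: "\<theta> \<in> W"
        using \<theta>(1) YS S_W by blast
      obtain \<eta>' where \<eta>': "\<eta>' < \<theta>" "\<eta> < \<eta>'"
        using S_finite_bounded[OF YS[OF \<theta>(1)], of "{\<eta>}"] \<theta>(2) by auto
      obtain c' where c': "c' \<in> C \<theta>" "\<eta>' \<le> c'"
        using C_cofinal[OF \<theta>W \<eta>'(1)] by blast
      have c'\<theta>: "c' < \<theta>"
        using c'(1) by (rule C_less)
      let ?g = "n c'"
      have g: "?g \<in> Y" "c' < ?g" "?g < \<theta>"
        using n[of c'] \<theta>(3)[OF c'\<theta>] W_down[OF \<theta>W c'\<theta>] by auto
      obtain \<nu> where \<nu>: "\<nu> \<in> K" "\<forall>x\<in>(\<lambda>\<xi>. e \<xi> (\<beta> \<theta>)) ` set (L ?g \<theta>). x < \<nu>"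
        using K_bounded[of "(\<lambda>\<xi>. e \<xi> (\<beta> \<theta>)) ` set (L ?g \<theta>)"] e_K finite_small
        by (metis finite_imageI finite_set image_subset_iff)
      have "\<eta> < \<xi>" if "\<xi> \<in> set (L ?g \<theta>)" for \<xi>
        using L_ge[OF c'(1) g(2,3) \<theta>W that] c'(2) \<eta>'(2) by order
      then have "H \<eta> \<nu> ?g \<theta>"
        unfolding H_def using g \<theta>(1) \<nu>(2) by auto
      then show ?thesis
        using \<nu>(1) by blast
    qed
    then obtain \<nu> g \<theta> where H: "\<And>\<eta>. \<eta> \<in> W \<Longrightarrow> \<nu> \<eta> \<in> K" "\<And>\<eta>. \<eta> \<in> W \<Longrightarrow> H \<eta> (\<nu> \<eta>) (g \<eta>) (\<theta> \<eta>)"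
      by metis
    obtain \<mu> where \<mu>: "\<mu> \<in> K" "unbounded {\<eta> \<in> W. \<nu> \<eta> = \<mu>}"
      using unbounded_pigeonhole[OF unbounded_W le_K_refl, of \<nu>] H(1) by blast
    then have "\<forall>\<eta>\<in>W. \<exists>y. y \<in> W \<and> \<eta> < y \<and> \<nu> y = \<mu>"
      unfolding unbounded_def by blast
    then obtain y where y: "\<And>\<eta>. \<eta> \<in> W \<Longrightarrow> y \<eta> \<in> W" "\<And>\<eta>. \<eta> \<in> W \<Longrightarrow> \<eta> < y \<eta>" "\<And>\<eta>. \<eta> \<in> W \<Longrightarrow> \<nu> (y \<eta>) = \<mu>"
      by metis
    have gY: "g \<eta> \<in> Y" if "\<eta> \<in> W" for \<eta>
      using H(2)[OF that] unfolding H_def by blast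
    obtain z where z: "z \<in> W"
      using K_subset K_infinite by fastforce
    obtain \<sigma> where \<sigma>: "\<sigma> \<in> Y" "\<And>\<eta>. \<eta> < \<sigma> \<Longrightarrow> g (y \<eta>) < \<sigma>"
      by (rule stationaryD[OF Y(1), of "\<lambda>\<eta>. g (y \<eta>)" z]) (use z y(1) gY stationary_W[OF Y(1)] in auto)
    have \<sigma>W: "\<sigma> \<in> W" "\<sigma> < \<alpha> \<sigma>" "\<alpha> \<sigma> \<in> W"
      using \<sigma>(1) YS S_W G by blast+
    \<comment> \<open>As \<open>e\<close> is less-than-kappa-to-one, the places with value at most
      \<open>\<mu>\<close> are bounded below \<open>\<sigma>\<close>; any trace above that bound
      works.\<close>
    have "small {\<xi>. \<xi> < \<sigma> \<and> e \<xi> (\<alpha> \<sigma>) \<le> \<mu>}"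
      by (rule small_subset[OF small_e_le[OF \<sigma>W(3) \<mu>(1)]]) (use \<sigma>W(2) in auto)
    then obtain \<eta> where \<eta>: "\<eta> < \<sigma>" "\<forall>\<xi>\<in>{\<xi>. \<xi> < \<sigma> \<and> e \<xi> (\<alpha> \<sigma>) \<le> \<mu>}. \<xi> < \<eta>"
      using S_bounded[OF YS[OF \<sigma>(1)]] by blast
    have \<eta>W: "\<eta> \<in> W"
      using W_down[OF \<sigma>W(1) \<eta>(1)] .
    let ?\<gamma> = "g (y \<eta>)" and ?\<theta> = "\<theta> (y \<eta>)"
    have H': "?\<gamma> \<in> Y" "?\<theta> \<in> Y" "?\<gamma> < ?\<theta>" "\<And>\<xi>. \<xi> \<in> set (L ?\<gamma> ?\<theta>) \<Longrightarrow> y \<eta> < \<xi> \<and> e \<xi> (\<beta> ?\<theta>) \<le> \<mu>"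
      using H(2)[OF y(1)[OF \<eta>W]] y(3)[OF \<eta>W] unfolding H_def by auto
    let ?l = "map (\<lambda>\<xi>. (\<xi>, e \<xi> (\<alpha> \<sigma>), e \<xi> (\<beta> ?\<theta>))) (L ?\<gamma> ?\<theta>)"
    have "e \<xi> (\<beta> ?\<theta>) < e \<xi> (\<alpha> \<sigma>)" if "\<xi> \<in> set (L ?\<gamma> ?\<theta>)" for \<xi>
    proof -
      have "\<xi> < \<sigma>"
        using L_le[OF that] \<sigma>(2)[OF \<eta>(1)] by order
      moreover have "\<not> \<xi> < \<eta>"
        using H'(4)[OF that] y(2)[OF \<eta>W] by auto
      ultimately have "\<not> e \<xi> (\<alpha> \<sigma>) \<le> \<mu>"
        using \<eta>(2) by blast
      then show ?thesis
        using H'(4)[OF that] by auto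
    qed
    then have "set (signs ?l) \<subseteq> {b}"
      using True by (auto simp: signs_def)
    moreover have "signs ?l \<noteq> []"
      using Lne[OF H'(3,2)] by simp
    ultimately have "set (signs ?l) = {b}"
      by (rule set_constant_list)
    moreover have "?\<gamma> < \<alpha> \<sigma>"
      using \<sigma>(2)[OF \<eta>(1)] \<sigma>W(2) by order
    ultimately show ?thesis
      using ext[OF H'(1,2) \<sigma>(1) H'(3)] H'(1) Y(2) by blast
  qed
qed

text \<open>The entries of a type at \<open>\<gamma>\<close> come from a set of size at most kappa
  fixed by some \<open>z < \<gamma>\<close>, so finite lists of them can be pressed down.\<close>

lemma type_fodor:
  assumes "stationary Z" "\<And>\<gamma>. \<gamma> \<in> Z \<Longrightarrow> \<gamma> \<in> T (f \<gamma> @ l \<gamma>)"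
  shows "\<exists>y. stationary {\<gamma> \<in> Z. l \<gamma> = y}"
proof (rule fodor[OF assms(1), of "\<lambda>z. lists ({..z} \<times> K \<times> K)"])
  fix z assume "z \<in> W"
  then show "le_K (lists ({..z} \<times> K \<times> K))"
    by (intro le_K_lists le_K_Times W_atMost le_K_refl)
next
  fix z z' :: 'b assume "z \<le> z'"
  then show "lists ({..z} \<times> K \<times> K) \<subseteq> lists ({..z'} \<times> K \<times> K)"
    by (intro lists_mono) auto
next
  fix \<gamma> assume "\<gamma> \<in> Z"
  then have \<gamma>: "\<gamma> \<in> T (f \<gamma> @ l \<gamma>)"
    by (rule assms(2))
  then have "x < \<gamma>" if "x \<in> fst ` set (l \<gamma>)" for x
    using T_elem(1)[OF \<gamma>] that by fastforce
  then obtain z where z: "z < \<gamma>" "\<forall>x\<in>fst ` set (l \<gamma>). x < z"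
    using S_finite_bounded[OF T_S[OF \<gamma>], of "fst ` set (l \<gamma>)"] by auto
  have "t \<in> {..z} \<times> K \<times> K" if "t \<in> set (l \<gamma>)" for t
  proof (cases t)
    case (fields \<xi> x y)
    then have "\<xi> < z"
      using z(2) that by force
    then show ?thesis
      using T_elem(2,3)[OF \<gamma>, of \<xi> x y] that fields by auto
  qed
  then show "\<exists>z<\<gamma>. l \<gamma> \<in> lists ({..z} \<times> K \<times> K)"
    using z(1) by (intro exI[of _ z]) auto
qed

text \<open>Were the points without an extension stationary, \<open>extension_exists\<close> would
  apply to them. So stationarily many points have extensions, and the added block is pressed down to
  a single one.\<close>

lemma extend:
  assumes "stationary Z" "Z \<subseteq> T l"
  obtains Z' l' where "stationary Z'" "Z' \<subseteq> Z" "set (signs l') = {b}" "Z' \<subseteq> T (l @ l')"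
proof -
  define Z1 where "Z1 = {\<gamma> \<in> Z. \<exists>l'. set (signs l') = {b} \<and> \<gamma> \<in> T (l @ l')}"
  have "le_K (UNIV :: bool set)"
    by (simp add: finite_small small_le_K)
  then obtain y where y: "stationary {\<gamma> \<in> Z. (\<gamma> \<in> Z1) = y}"
    using fodor_le_K[OF assms(1), of UNIV "\<lambda>\<gamma>. \<gamma> \<in> Z1"] by auto
  obtain \<gamma> where "\<gamma> \<in> {\<gamma> \<in> Z. (\<gamma> \<in> Z1) = y}" "\<exists>l'. set (signs l') = {b} \<and> \<gamma> \<in> T (l @ l')"
    using extension_exists[OF y, of l b] assms(2) by blast
  then have "y = True"
    unfolding Z1_def by blast
  then have Z1: "stationary Z1"
    using y by (elim stationary_mono) (use assms(1) stationary_W Z1_def in auto)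
  have "\<forall>\<gamma>\<in>Z1. \<exists>l'. set (signs l') = {b} \<and> \<gamma> \<in> T (l @ l')"
    unfolding Z1_def by blast
  then obtain k where k: "\<And>\<gamma>. \<gamma> \<in> Z1 \<Longrightarrow> set (signs (k \<gamma>)) = {b}" "\<And>\<gamma>. \<gamma> \<in> Z1 \<Longrightarrow> \<gamma> \<in> T (l @ k \<gamma>)"
    by metis
  obtain l' where l': "stationary {\<gamma> \<in> Z1. k \<gamma> = l'}"
    using type_fodor[OF Z1, of "\<lambda>_. l" k] k(2) by blast
  obtain z where "z \<in> W"
    using K_subset K_infinite by fastforce
  then obtain \<gamma> where "\<gamma> \<in> Z1" "k \<gamma> = l'"
    using stationaryD[OF l', of "\<lambda>x. x" z] by auto
  then have "set (signs l') = {b}"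
    using k(1) by blast
  then show thesis
    using that[OF l', of l'] k(2) Z1_def by blast
qed

lemma extend_oscillation:
  assumes "stationary Z" "Z \<subseteq> T l"
  obtains Z' fs ts where "stationary Z'" "Z' \<subseteq> Z" "set (signs fs) = {False}" "set (signs ts) = {True}" "Z' \<subseteq> T (l @ fs @ ts)"
proof -
  obtain Z1 fs where 1: "stationary Z1" "Z1 \<subseteq> Z" "set (signs fs) = {False}" "Z1 \<subseteq> T (l @ fs)"
    by (rule extend[OF assms])
  obtain Z2 ts where 2: "stationary Z2" "Z2 \<subseteq> Z1" "set (signs ts) = {True}" "Z2 \<subseteq> T ((l @ fs) @ ts)"
    by (rule extend[OF 1(1,4)])
  show thesis
    by (rule that[OF 2(1) _ 1(3) 2(3)]) (use 1 2 in auto)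
qed

text \<open>Each round appends a false block and a true block, gaining one rise. The stationary sets
  only shrink, so the earlier prefixes stay realized over the last set.\<close>

lemma chain:
  assumes "stationary Z0" "Z0 \<subseteq> T l0" "l0 \<noteq> []" "last (signs l0)"
  shows "\<exists>Z l. stationary Z \<and> Z \<subseteq> T l \<and> l \<noteq> [] \<and> last (signs l) \<and> rises (signs l) = rises (signs l0) + n \<and>
    (\<forall>i\<le>n. \<exists>p q. l = p @ q \<and> p \<noteq> [] \<and> last (signs p) \<and> rises (signs p) = rises (signs l0) + i \<and> Z \<subseteq> T p)"
proof (induction n)
  case 0
  show ?case
    by (rule exI[of _ Z0], rule exI[of _ l0]) (use assms in auto)
next
  case (Suc n)
  then obtain Z l where *: "stationary Z" "Z \<subseteq> T l" "l \<noteq> []" "last (signs l)" "rises (signs l) = rises (signs l0) + n"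
    and p: "\<forall>i\<le>n. \<exists>p q. l = p @ q \<and> p \<noteq> [] \<and> last (signs p) \<and> rises (signs p) = rises (signs l0) + i \<and> Z \<subseteq> T p"
    by blast
  obtain Z' fs ts where Z': "stationary Z'" "Z' \<subseteq> Z" "set (signs fs) = {False}" "set (signs ts) = {True}" "Z' \<subseteq> T (l @ fs @ ts)"
    by (rule extend_oscillation[OF *(1,2)])
  have rises: "rises (signs (l @ fs @ ts)) = rises (signs l0) + Suc n" "last (signs (l @ fs @ ts))"
    using rises_new_oscillation[of "signs l" "signs fs" "signs ts"] * Z' by auto
  have "\<exists>p q. l @ fs @ ts = p @ q \<and> p \<noteq> [] \<and> last (signs p) \<and> rises (signs p) = rises (signs l0) + i \<and> Z' \<subseteq> T p"
    if "i \<le> Suc n" for i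
  proof (cases "i = Suc n")
    case True
    then show ?thesis
      using rises Z'(5) *(3) by (intro exI[of _ "l @ fs @ ts"] exI[of _ "[]"]) auto
  next
    case False
    then have "i \<le> n"
      using that by simp
    then obtain p q where "l = p @ q" "p \<noteq> []" "last (signs p)" "rises (signs p) = rises (signs l0) + i" "Z \<subseteq> T p"
      using p by blast
    then show ?thesis
      using Z'(2) by (intro exI[of _ p] exI[of _ "q @ fs @ ts"]) auto
  qed
  then show ?case
    using Z'(1,5) rises *(3) by (intro exI[of _ Z'] exI[of _ "l @ fs @ ts"]) auto
qed

text \<open>A single first coordinate serves all \<open>i\<close>. Over one point
  \<open>\<gamma>\<close>, the \<open>i\<close>-th second coordinate realizes the prefix with
  \<open>i\<close> extra rises, and the rest of the trace, from \<open>\<gamma>\<close> down,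
  contributes the same amount for all \<open>i\<close>.\<close>

lemma oscillation:
  "\<exists>m. \<forall>i\<le>n. \<exists>\<alpha>\<in>A. \<exists>\<delta> \<beta>. (\<delta>, \<beta>) \<in> D \<and> \<alpha> < \<delta> \<and> osc \<alpha> \<beta> = m + i"
proof -
  have "\<exists>l. \<gamma> \<in> T l" if \<gamma>: "\<gamma> \<in> S" for \<gamma>
  proof -
    obtain \<alpha> where "\<alpha> \<in> A" "\<gamma> < \<alpha>"
      using A_unbounded S_W[OF \<gamma>] unfolding unbounded_def by blast
    moreover obtain \<delta> \<beta> where "(\<delta>, \<beta>) \<in> D" "\<gamma> < \<delta>"
      using D_unbounded[OF S_W[OF \<gamma>]] by blast
    ultimately show ?thesis
      using T_I[OF \<gamma>] by blast
  qed
  then obtain k where k: "\<And>\<gamma>. \<gamma> \<in> S \<Longrightarrow> \<gamma> \<in> T (k \<gamma>)"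
    by metis
  obtain l where "stationary {\<gamma> \<in> S. k \<gamma> = l}"
    using type_fodor[OF stationary_S, of "\<lambda>_. []" k] k by auto
  moreover have "{\<gamma> \<in> S. k \<gamma> = l} \<subseteq> T l"
    using k by blast
  \<comment> \<open>One extension makes the initial list nonempty and ending in \<open>True\<close>,
    the starting condition of \<open>chain\<close>.\<close>
  ultimately obtain Z0 fs ts where Z0: "stationary Z0" "set (signs fs) = {False}" "set (signs ts) = {True}" "Z0 \<subseteq> T (l @ fs @ ts)"
    using extend_oscillation by metis
  define l0 where "l0 = l @ fs @ ts"
  have "signs ts \<noteq> []"
    using Z0(3) by force
  then have "last (signs ts) \<in> set (signs ts)" "ts \<noteq> []"
    by simp_all
  then have "l0 \<noteq> []" "last (signs l0)"
    unfolding Z0(3) by (simp_all add: l0_def)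
  then obtain Z l where Z: "stationary Z" "Z \<subseteq> T l"
    and p: "\<forall>i\<le>n. \<exists>p q. l = p @ q \<and> p \<noteq> [] \<and> last (signs p) \<and> rises (signs p) = rises (signs l0) + i \<and> Z \<subseteq> T p"
    using chain[OF Z0(1) Z0(4)[folded l0_def], of n] by blast
  have ZS: "\<gamma> \<in> S" if "\<gamma> \<in> Z" for \<gamma>
    using that Z(2) T_S by blast
  have "\<exists>\<alpha>. \<alpha> \<in> A \<and> x < \<alpha> \<and> (\<forall>\<xi> u v. (\<xi>, u, v) \<in> set l \<longrightarrow> e \<xi> \<alpha> = u)" if x: "x \<in> W" for x
  proof -
    obtain \<sigma> where \<sigma>: "\<sigma> \<in> Z" "x < \<sigma>"
      using stationary_unbounded[OF Z(1)] x unfolding unbounded_def by blast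
    then have "\<sigma> \<in> T l"
      using Z(2) by blast
    then obtain \<alpha> \<delta> \<beta> where "\<alpha> \<in> A" "\<sigma> < \<alpha>" "tp \<alpha> \<beta> \<sigma> = l"
      by (rule T_E)
    then show ?thesis
      using tp_e \<sigma>(2) by (intro exI[of _ \<alpha>]) auto
  qed
  then obtain a where a: "\<And>x. x \<in> W \<Longrightarrow> a x \<in> A" "\<And>x. x \<in> W \<Longrightarrow> x < a x"
      "\<And>x \<xi> u v. x \<in> W \<Longrightarrow> (\<xi>, u, v) \<in> set l \<Longrightarrow> e \<xi> (a x) = u"
    by metis
  have AW: "A \<subseteq> W"
    using A_unbounded unfolding unbounded_def by blast
  obtain z where z: "z \<in> W"
    using K_subset K_infinite by fastforce
  \<comment> \<open>Closure under \<open>a\<close> will place a suitable element of \<open>A\<close>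
    between the later \<open>c\<close> and \<open>\<gamma>\<close>.\<close>
  obtain \<gamma> where \<gamma>: "\<gamma> \<in> Z" "\<And>x. x < \<gamma> \<Longrightarrow> a x < \<gamma>"
    by (rule stationaryD[OF Z(1), of a z]) (use z a(1) AW in auto)
  have \<gamma>T: "\<gamma> \<in> T l" and \<gamma>S: "\<gamma> \<in> S" and \<gamma>W: "\<gamma> \<in> W"
    using \<gamma>(1) Z(2) ZS S_W by blast+
  define G where "G i p \<alpha> \<delta> \<beta> \<eta> \<longleftrightarrow> (\<exists>q. l = p @ q) \<and> p \<noteq> [] \<and> last (signs p) \<and> rises (signs p) = rises (signs l0) + i \<and>
      (\<delta>, \<beta>) \<in> D \<and> \<gamma> < \<delta> \<and> \<gamma> < \<beta> \<and> \<beta> \<in> W \<and> tp \<alpha> \<beta> \<gamma> = p \<and>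
      \<eta> < \<gamma> \<and> (\<forall>\<xi>. \<eta> \<le> \<xi> \<and> \<xi> < \<gamma> \<longrightarrow> e \<xi> \<gamma> = e \<xi> \<beta>)" for i p \<alpha> \<delta> \<beta> \<eta>
  have "\<exists>p \<alpha> \<delta> \<beta> \<eta>. G i p \<alpha> \<delta> \<beta> \<eta>" if "i \<le> n" for i
  proof -
    obtain p q where pq: "l = p @ q" "p \<noteq> []" "last (signs p)" "rises (signs p) = rises (signs l0) + i" "Z \<subseteq> T p"
      using p \<open>i \<le> n\<close> by blast
    then have "\<gamma> \<in> T p"
      using \<gamma>(1) by blast
    then obtain \<alpha> \<delta> \<beta> where *: "(\<delta>, \<beta>) \<in> D" "\<gamma> < \<delta>" "\<gamma> < \<beta>" "tp \<alpha> \<beta> \<gamma> = p" "\<beta> \<in> W"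
      by (rule T_E)
    obtain \<eta> where "\<eta> < \<gamma>" "\<forall>\<xi>. \<eta> \<le> \<xi> \<and> \<xi> < \<gamma> \<longrightarrow> e \<xi> \<gamma> = e \<xi> \<beta>"
      using e_eventually_equal[OF \<gamma>S *(3,5)] by blast
    then show ?thesis
      using pq * unfolding G_def by blast
  qed
  then obtain p \<alpha> \<delta> \<beta> \<eta> where G: "\<And>i. i \<le> n \<Longrightarrow> G i (p i) (\<alpha> i) (\<delta> i) (\<beta> i) (\<eta> i)"
    by metis
  have pq: "(\<exists>q. l = p i @ q) \<and> p i \<noteq> [] \<and> last (signs (p i)) \<and> rises (signs (p i)) = rises (signs l0) + i"
    and D: "(\<delta> i, \<beta> i) \<in> D \<and> \<gamma> < \<delta> i \<and> \<gamma> < \<beta> i \<and> \<beta> i \<in> W"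
    and tp: "tp (\<alpha> i) (\<beta> i) \<gamma> = p i"
    and \<eta>: "\<eta> i < \<gamma>" "\<And>\<xi>. \<eta> i \<le> \<xi> \<Longrightarrow> \<xi> < \<gamma> \<Longrightarrow> e \<xi> \<gamma> = e \<xi> (\<beta> i)" if "i \<le> n" for i
    using G[OF that] unfolding G_def by auto
  have "x < \<gamma>" if "x \<in> fst ` set l \<union> \<eta> ` {..n}" for x
    using that T_elem(1)[OF \<gamma>T] \<eta>(1) by fastforce
  then obtain \<zeta> where \<zeta>: "\<zeta> < \<gamma>" "\<forall>x\<in>fst ` set l \<union> \<eta> ` {..n}. x < \<zeta>"
    using S_finite_bounded[OF \<gamma>S, of "fst ` set l \<union> \<eta> ` {..n}"] by auto
  obtain c where c: "c \<in> C \<gamma>" "\<zeta> \<le> c"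
    using C_cofinal[OF \<gamma>W \<zeta>(1)] by blast
  have c\<gamma>: "c < \<gamma>" "c \<in> W"
    using C_less[OF c(1)] W_down[OF \<gamma>W] by auto
  define \<alpha>' where "\<alpha>' = a c"
  have \<alpha>': "\<alpha>' \<in> A" "c < \<alpha>'" "\<alpha>' < \<gamma>" "\<And>\<xi> u v. (\<xi>, u, v) \<in> set l \<Longrightarrow> e \<xi> \<alpha>' = u"
    using a[OF c\<gamma>(2)] \<gamma>(2)[OF c\<gamma>(1)] by (auto simp: \<alpha>'_def)
  \<comment> \<open>The signs on the common tail are taken against \<open>\<gamma>\<close>, since
    above \<open>c\<close> every \<open>\<beta> i\<close> agrees with \<open>\<gamma>\<close>; this
    makes \<open>\<tau>\<close> independent of \<open>i\<close>.\<close>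
  define \<tau> where "\<tau> = map (\<lambda>\<xi>. e \<xi> \<gamma> < e \<xi> \<alpha>') (L \<alpha>' \<gamma>)"
  have "osc \<alpha>' (\<beta> i) = rises (signs l0) + rises (True # \<tau>) + i" if i: "i \<le> n" for i
  proof -
    have sub: "set (p i) \<subseteq> set l"
      using pq[OF i] by auto
    have "x \<le> c" if "(x, u, v) \<in> set l" for x u v
    proof -
      have "fst (x, u, v) < \<zeta>"
        using \<zeta>(2) that by blast
      then show ?thesis
        using c(2) by simp
    qed
    then have "tp \<alpha>' (\<beta> i) \<alpha>' = p i @ map (\<lambda>\<xi>. (\<xi>, e \<xi> \<alpha>', e \<xi> (\<beta> i))) (L \<alpha>' \<gamma>)"
      using D[OF i] sub \<alpha>' by (intro tp_extend[OF _ _ _ c(1) _ tp[OF i]]) auto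
    moreover have "map (\<lambda>\<xi>. e \<xi> (\<beta> i) < e \<xi> \<alpha>') (L \<alpha>' (\<beta> i)) = signs (tp \<alpha>' (\<beta> i) \<alpha>')"
      by (simp add: signs_def tp_def)
    moreover have "signs (map (\<lambda>\<xi>. (\<xi>, e \<xi> \<alpha>', e \<xi> (\<beta> i))) (L \<alpha>' \<gamma>)) = \<tau>"
      unfolding \<tau>_def signs_def map_map
    proof (rule map_cong[OF refl])
      fix \<xi> assume \<xi>: "\<xi> \<in> set (L \<alpha>' \<gamma>)"
      have "c \<le> \<xi>" "\<xi> < \<gamma>"
        using L_ge[OF c(1) \<alpha>'(2,3) \<gamma>W \<xi>] L_le[OF \<xi>] \<alpha>'(3) by auto
      moreover have "\<eta> i < c"
        using \<zeta>(2) c(2) i less_le_trans by blast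
      ultimately have "e \<xi> \<gamma> = e \<xi> (\<beta> i)"
        using \<eta>(2)[OF i] by auto
      then show "((\<lambda>(\<xi>, x, y). y < x) \<circ> (\<lambda>\<xi>. (\<xi>, e \<xi> \<alpha>', e \<xi> (\<beta> i)))) \<xi> = (e \<xi> \<gamma> < e \<xi> \<alpha>')"
        by simp
    qed
    ultimately have "osc \<alpha>' (\<beta> i) = rises (signs (p i) @ \<tau>)"
      by (simp add: osc_def)
    \<comment> \<open>All prefixes end in \<open>True\<close>, so the rise count across the junction
      with \<open>\<tau>\<close> is the same for each.\<close>
    also have "\<dots> = rises (signs (p i)) + rises (True # \<tau>)"
      using rises_append[of "signs (p i)" \<tau>] pq[OF i] by simp
    finally show ?thesis
      using pq[OF i] by simp
  qed
  moreover have "\<alpha>' < \<delta> i" if "i \<le> n" for i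
    using \<alpha>'(3) D[OF that] by auto
  ultimately show ?thesis
    using \<alpha>'(1) D by (intro exI[of _ "rises (signs l0) + rises (True # \<tau>)"]) blast
qed

end

context succ_card
begin

text \<open>The colour is the label under \<open>\<pi>\<close> of the place reached after
  \<open>val2 (osc \<alpha> \<beta>)\<close> steps of the walk.\<close>

theorem rectangular_colouring:
  "\<exists>F. \<forall>A B. unbounded A \<longrightarrow> unbounded B \<longrightarrow> (\<forall>\<gamma>\<in>W. \<exists>\<alpha>\<in>A. \<exists>\<beta>\<in>B. \<alpha> < \<beta> \<and> F \<alpha> \<beta> = \<gamma>)"
proof -
  obtain \<pi> where \<pi>: "\<And>\<gamma>. \<gamma> \<in> W \<Longrightarrow> stationary {\<delta> \<in> S. \<pi> \<delta> = \<gamma>}"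
    using S_split by blast
  have "\<exists>\<alpha>\<in>A. \<exists>\<beta>\<in>B. \<alpha> < \<beta> \<and> \<pi> (walk \<alpha> \<beta> (val2 (osc \<alpha> \<beta>))) = \<gamma>"
    if A: "unbounded A" and B: "unbounded B" and \<gamma>: "\<gamma> \<in> W" for A B \<gamma>
  proof -
    define Z where "Z = {\<delta> \<in> S. \<pi> \<delta> = \<gamma>}"
    have Z: "stationary Z" "\<And>\<delta>. \<delta> \<in> Z \<Longrightarrow> \<delta> \<in> S" "\<And>\<delta>. \<delta> \<in> Z \<Longrightarrow> \<pi> \<delta> = \<gamma>"
      using \<pi>[OF \<gamma>] unfolding Z_def by auto
    have "\<exists>\<beta> \<xi>. \<beta> \<in> B \<and> \<delta> < \<beta> \<and> \<xi> < \<delta> \<and> (\<forall>x\<in>set (L \<delta> \<beta>). x < \<xi>)" if "\<delta> \<in> Z" for \<delta>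
    proof -
      have \<delta>: "\<delta> \<in> S"
        using that by (rule Z(2))
      obtain \<beta> where "\<beta> \<in> B" "\<delta> < \<beta>"
        using B S_W[OF \<delta>] unfolding unbounded_def by blast
      moreover obtain \<xi> where "\<xi> < \<delta>" "\<forall>x\<in>set (L \<delta> \<beta>). x < \<xi>"
        using S_finite_bounded[OF \<delta>, of "set (L \<delta> \<beta>)"] L_less_S[OF \<delta>] by auto
      ultimately show ?thesis
        by blast
    qed
    then obtain b x where b: "\<And>\<delta>. \<delta> \<in> Z \<Longrightarrow> b \<delta> \<in> B" "\<And>\<delta>. \<delta> \<in> Z \<Longrightarrow> \<delta> < b \<delta>"
      and x: "\<And>\<delta>. \<delta> \<in> Z \<Longrightarrow> x \<delta> < \<delta>" "\<And>\<delta> y. \<delta> \<in> Z \<Longrightarrow> y \<in> set (L \<delta> (b \<delta>)) \<Longrightarrow> y < x \<delta>"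
      by metis
    \<comment> \<open>Fixing the number of steps \<open>n\<close> and the bound
      \<open>\<xi>\<close>: for every remaining \<open>\<delta>\<close>, the walk from
      \<open>b \<delta>\<close> to any \<open>\<alpha>\<close> with
      \<open>\<xi> < \<alpha> < \<delta>\<close> is at \<open>\<delta>\<close> after
      \<open>n\<close> steps.\<close>
    have "\<exists>y. stationary {\<delta> \<in> Z. (length (L \<delta> (b \<delta>)), x \<delta>) = y}"
    proof (rule fodor[OF Z(1), of "\<lambda>z. UNIV \<times> {..z}"])
      show "le_K ((UNIV :: nat set) \<times> {..z})" if "z \<in> W" for z
        using that by (intro le_K_Times le_K_nat W_atMost)
      show "\<exists>z<\<delta>. (length (L \<delta> (b \<delta>)), x \<delta>) \<in> UNIV \<times> {..z}" if "\<delta> \<in> Z" for \<delta>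
        using x(1)[OF that] by auto
    qed auto
    then obtain y where y: "stationary {\<delta> \<in> Z. (length (L \<delta> (b \<delta>)), x \<delta>) = y}"
      by blast
    obtain n \<xi> where n\<xi>: "y = (n, \<xi>)"
      by (cases y)
    define Y where "Y = {\<delta> \<in> Z. (length (L \<delta> (b \<delta>)), x \<delta>) = (n, \<xi>)}"
    have Y: "stationary Y" "\<And>\<delta>. \<delta> \<in> Y \<Longrightarrow> \<delta> \<in> Z" "\<And>\<delta>. \<delta> \<in> Y \<Longrightarrow> length (L \<delta> (b \<delta>)) = n"
        "\<And>\<delta>. \<delta> \<in> Y \<Longrightarrow> x \<delta> = \<xi>"
      using y unfolding n\<xi> Y_def by auto
    have BW: "B \<subseteq> W"
      using B unfolding unbounded_def by blast
    have \<xi>W: "\<xi> \<in> W"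
    proof -
      obtain \<delta> where "\<delta> \<in> Y"
        using stationaryD[OF Y(1), of "\<lambda>x. x" \<gamma>] \<gamma> by blast
      then show ?thesis
        using x(1)[of \<delta>] Y(2,4) Z(2) S_W W_down by blast
    qed
    interpret rectangle W K "{\<alpha> \<in> A. \<xi> < \<alpha>}" "{(\<delta>, b \<delta>) |\<delta>. \<delta> \<in> Y}"
    proof
      show "unbounded {\<alpha> \<in> A. \<xi> < \<alpha>}"
        using A \<xi>W by (rule unbounded_inter)
      show "\<exists>\<delta> \<beta>. (\<delta>, \<beta>) \<in> {(\<delta>, b \<delta>) |\<delta>. \<delta> \<in> Y} \<and> z < \<delta>" if "z \<in> W" for z
      proof -
        obtain \<delta> where "\<delta> \<in> Y" "z < \<delta>"
          using stationary_unbounded[OF Y(1)] \<open>z \<in> W\<close> unfolding unbounded_def by blast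
        then show ?thesis
          by blast
      qed
      show "\<beta> \<in> W" if "(\<delta>, \<beta>) \<in> {(\<delta>, b \<delta>) |\<delta>. \<delta> \<in> Y}" for \<delta> \<beta>
        using that b(1) Y(2) BW by auto
      show "\<delta> \<le> \<beta>" if "(\<delta>, \<beta>) \<in> {(\<delta>, b \<delta>) |\<delta>. \<delta> \<in> Y}" for \<delta> \<beta>
        using that b(2) Y(2) by (auto intro: less_imp_le)
    qed
    \<comment> \<open>\<open>oscillation\<close> supplies all values in some interval from
      \<open>m\<close> to \<open>m + N\<close>, and \<open>N\<close> is long enough for one of them
      to have valuation \<open>n\<close>.\<close>
    obtain N where N: "\<And>m. \<exists>i\<le>N. val2 (m + i) = n"
      using val2_syndetic by meson
    obtain m where m: "\<forall>i\<le>N. \<exists>\<alpha>\<in>{\<alpha> \<in> A. \<xi> < \<alpha>}. \<exists>\<delta> \<beta>. (\<delta>, \<beta>) \<in> {(\<delta>, b \<delta>) |\<delta>. \<delta> \<in> Y} \<and> \<alpha> < \<delta> \<and> osc \<alpha> \<beta> = m + i"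
      using oscillation by blast
    obtain i where i: "i \<le> N" "val2 (m + i) = n"
      using N by blast
    obtain \<alpha> \<delta> where \<alpha>: "\<alpha> \<in> A" "\<xi> < \<alpha>" "\<delta> \<in> Y" "\<alpha> < \<delta>" "osc \<alpha> (b \<delta>) = m + i"
      using m i(1) by blast
    note \<delta> = Y(2-4)[OF \<alpha>(3)]
    have "walk \<alpha> (b \<delta>) (length (L \<delta> (b \<delta>))) = \<delta>"
    proof (rule walk_through[THEN conjunct1, OF _ \<alpha>(4)])
      show "b \<delta> \<in> W" "\<delta> \<le> b \<delta>"
        using b[OF \<delta>(1)] BW by auto
      show "y < \<alpha>" if "y \<in> set (L \<delta> (b \<delta>))" for y
        using x(2)[OF \<delta>(1) that] \<delta>(3) \<alpha>(2) by auto
    qed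
    then have "\<pi> (walk \<alpha> (b \<delta>) (val2 (osc \<alpha> (b \<delta>)))) = \<gamma>"
      using \<delta> \<alpha>(5) i(2) Z(3) by simp
    moreover have "b \<delta> \<in> B" "\<alpha> < b \<delta>"
      using b[OF \<delta>(1)] \<alpha>(4) by auto
    ultimately show ?thesis
      using \<alpha>(1) by blast
  qed
  then show ?thesis
    by (intro exI[of _ "\<lambda>\<alpha> \<beta>. \<pi> (walk \<alpha> \<beta> (val2 (osc \<alpha> \<beta>)))"]) blast
qed

end

section \<open>Initial segments of a well-ordered type\<close>

text \<open>The order of a cardinal successor on a given type embeds as an initial segment into the following
  order, for which the class \<open>wellorder\<close> is available.\<close>

typedef 'a wo = "UNIV :: 'a set"
  by simp

instantiation wo :: (type) wellorder
begin

definition less_eq_wo :: "'a wo \<Rightarrow> 'a wo \<Rightarrow> bool" where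
  "x \<le> y \<longleftrightarrow> (Rep_wo x, Rep_wo y) \<in> |UNIV :: 'a set|"

definition less_wo :: "'a wo \<Rightarrow> 'a wo \<Rightarrow> bool" where
  "(x :: 'a wo) < y \<longleftrightarrow> x \<le> y \<and> \<not> y \<le> x"

instance
proof
  have wo: "well_order_on UNIV |UNIV :: 'a set|"
    by (rule card_of_well_order_on)
  note defs = well_order_on_def linear_order_on_def partial_order_on_def preorder_on_def
  have ordr: "refl |UNIV :: 'a set|" "trans |UNIV :: 'a set|" "antisym |UNIV :: 'a set|" "total |UNIV :: 'a set|"
    and wf: "wf ( |UNIV :: 'a set| - Id)"
    using wo unfolding defs by auto
  fix x y z :: "'a wo"
  show "x < y \<longleftrightarrow> x \<le> y \<and> \<not> y \<le> x"
    by (rule less_wo_def)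
  show "x \<le> x"
    using ordr(1) unfolding less_eq_wo_def refl_on_def by blast
  show "x \<le> z" if "x \<le> y" "y \<le> z"
    using that ordr(2) unfolding less_eq_wo_def trans_def by blast
  show "x = y" if "x \<le> y" "y \<le> x"
    using that ordr(3) Rep_wo_inject unfolding less_eq_wo_def antisym_def by blast
  show "x \<le> y \<or> y \<le> x"
    using ordr(1,4) unfolding less_eq_wo_def total_on_def refl_on_def by (cases "Rep_wo x = Rep_wo y") auto
  show "P x" if step: "\<And>x. (\<And>y. y < x \<Longrightarrow> P y) \<Longrightarrow> P x" for P and x :: "'a wo"
  proof -
    have "P (Abs_wo u)" for u
    proof (induction u rule: wf_induct_rule[OF wf])
      case (1 u)
      show ?case
      proof (rule step)
        fix y assume "y < Abs_wo u"
        then have "(Rep_wo y, u) \<in> |UNIV :: 'a set|" "(u, Rep_wo y) \<notin> |UNIV :: 'a set|"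
          unfolding less_wo_def less_eq_wo_def by (simp_all add: Abs_wo_inverse)
        then have "(Rep_wo y, u) \<in> |UNIV :: 'a set| - Id"
          by auto
        then have "P (Abs_wo (Rep_wo y))"
          by (rule 1)
        then show "P y"
          by (simp add: Rep_wo_inverse)
      qed
    qed
    then show ?thesis
      by (metis Rep_wo_inverse)
  qed
qed

end

text \<open>The image of an embedding is an initial segment, so order and size facts about
  \<open>r\<close> become facts about the class order.\<close>

lemma embed_wo:
  fixes r :: "'c rel" and f :: "'c \<Rightarrow> 'b"
  assumes r: "Card_order r" and f: "embed r |UNIV :: 'b set| f"
  defines "V \<equiv> (Abs_wo \<circ> f) ` Field r"
  shows "inj_on (Abs_wo \<circ> f) (Field r)"
    and "|V| =o r"
    and "x \<in> V \<Longrightarrow> y < x \<Longrightarrow> y \<in> V"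
    and "x \<in> V \<Longrightarrow> |{..<x}| <o r"
    and "a \<in> Field r \<Longrightarrow> b \<in> Field r \<Longrightarrow> (Abs_wo \<circ> f) a < (Abs_wo \<circ> f) b \<Longrightarrow> (a, b) \<in> r \<and> a \<noteq> b"
proof -
  have wr: "Well_order r"
    using r by (simp add: card_order_on_well_order_on)
  have inj: "inj_on f (Field r)"
    using embed_inj_on[OF wr f] .
  then show inj': "inj_on (Abs_wo \<circ> f) (Field r)"
    by (auto simp: inj_on_def Abs_wo_inject)
  then have "|V| =o |Field r|"
    unfolding V_def using card_of_ordIsoI ordIso_symmetric by (metis bij_betw_imageI)
  then show "|V| =o r"
    using card_of_Field_ordIso[OF r] ordIso_transitive by blast
  have uF: "underS r a \<subseteq> Field r" for a
    by (auto simp: underS_def Field_def)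
  have below: "{..<(Abs_wo \<circ> f) a} = (Abs_wo \<circ> f) ` underS r a" if a: "a \<in> Field r" for a
  proof -
    have "f ` underS r a = underS |UNIV :: 'b set| (f a)"
      using embed_underS[OF wr f a] by (simp add: bij_betw_def)
    moreover have "{..<Abs_wo u} = Abs_wo ` underS |UNIV :: 'b set| u" for u :: 'b
    proof (intro equalityI subsetI)
      fix y assume "y \<in> {..<Abs_wo u}"
      then have "y \<le> Abs_wo u" "y \<noteq> Abs_wo u"
        by auto
      then have "Rep_wo y \<in> underS |UNIV :: 'b set| u"
        unfolding less_eq_wo_def underS_def by (auto simp: Abs_wo_inverse Rep_wo_inverse)
      then show "y \<in> Abs_wo ` underS |UNIV :: 'b set| u"
        by (metis Rep_wo_inverse imageI)
    next
      fix y assume "y \<in> Abs_wo ` underS |UNIV :: 'b set| u"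
      then obtain v where "y = Abs_wo v" "v \<noteq> u" "(v, u) \<in> |UNIV :: 'b set|"
        unfolding underS_def by blast
      then have "y \<le> Abs_wo u" "y \<noteq> Abs_wo u"
        unfolding less_eq_wo_def by (auto simp: Abs_wo_inverse Abs_wo_inject)
      then show "y \<in> {..<Abs_wo u}"
        by simp
    qed
    ultimately show ?thesis
      by (metis comp_apply image_comp)
  qed
  show "y \<in> V" if xy: "x \<in> V" "y < x" for x y
  proof -
    obtain a where a: "a \<in> Field r" "x = (Abs_wo \<circ> f) a"
      using xy(1) unfolding V_def by blast
    then have "y \<in> (Abs_wo \<circ> f) ` underS r a"
      using below[OF a(1)] xy(2) by blast
    then show ?thesis
      unfolding V_def using uF[of a] by blast
  qed
  show "|{..<x}| <o r" if x: "x \<in> V"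
  proof -
    obtain a where a: "a \<in> Field r" "x = (Abs_wo \<circ> f) a"
      using x unfolding V_def by blast
    then show ?thesis
      using below[OF a(1)] card_of_image card_of_underS[OF r a(1)] ordLeq_ordLess_trans by metis
  qed
  show "(a, b) \<in> r \<and> a \<noteq> b" if "a \<in> Field r" "b \<in> Field r" "(Abs_wo \<circ> f) a < (Abs_wo \<circ> f) b"
  proof -
    have "(Abs_wo \<circ> f) a \<in> (Abs_wo \<circ> f) ` underS r b"
      using below[OF that(2)] that(3) by blast
    then obtain a' where a': "a' \<in> underS r b" "(Abs_wo \<circ> f) a = (Abs_wo \<circ> f) a'"
      by blast
    then have "a = a'"
      using inj_onD[OF inj' _ that(1)] uF[of b] by blast
    then show ?thesis
      using a'(1) unfolding underS_def by blast
  qed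
qed

section \<open>Colourings of pairs over partitions\<close>

theorem cardSuc_rectangular_colouring:
  fixes k :: "'a rel"
  assumes "Card_order k" "infinite (Field k)" "regularCard k"
  shows "\<exists>F. \<forall>A B. A \<subseteq> Field (cardSuc k) \<longrightarrow> B \<subseteq> Field (cardSuc k) \<longrightarrow> |A| =o cardSuc k \<longrightarrow> |B| =o cardSuc k \<longrightarrow>
    (\<forall>\<gamma>\<in>Field (cardSuc k). \<exists>(\<alpha>, \<beta>)\<in>circ_pairs (cardSuc k) A B. F \<alpha> \<beta> = \<gamma>)"
proof -
  let ?r = "cardSuc k"
  have r: "Card_order ?r"
    using assms(1) by (rule cardSuc_Card_order)
  have "?r \<le>o |UNIV :: 'a set set|"
  proof -
    have "?r =o |Field ?r|"
      using card_of_Field_ordIso[OF r] ordIso_symmetric by blast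
    then show ?thesis
      using card_of_mono1[of "Field ?r" UNIV] ordIso_ordLeq_trans by blast
  qed
  then obtain f where f: "embed ?r |UNIV :: 'a set set| f"
    unfolding ordLeq_def by blast
  obtain g where "embed k ?r g"
    using cardSuc_ordLeq[OF assms(1)] unfolding ordLeq_def by blast
  then have fg: "embed k |UNIV :: 'a set set| (f \<circ> g)" and gF: "g ` Field k \<subseteq> Field ?r"
    using comp_embed f embed_Field by blast+
  \<comment> \<open>The embedding of \<open>k\<close> into its successor is composed with the same
    \<open>f\<close>, so the copy \<open>K\<close> lies inside the copy \<open>W\<close>.\<close>
  define h where "h = Abs_wo \<circ> f"
  define W where "W = h ` Field ?r"
  define K where "K = (Abs_wo \<circ> (f \<circ> g)) ` Field k"
  note W = embed_wo[OF r f, folded h_def, folded W_def]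
  note K = embed_wo[OF assms(1) fg, folded K_def]
  have kK: "k =o |K|"
    using K(2) by (rule ordIso_symmetric)
  interpret succ_card W K
  proof
    show "K \<subseteq> W"
      using gF unfolding K_def W_def h_def by auto
    show "infinite K"
      using assms(2) unfolding K_def finite_image_iff[OF K(1)] .
    have "Cinfinite k"
      using assms by (simp add: cinfinite_def)
    then show "regularCard |K|"
      using regularCard_ordIso[OF kK] assms(3) by blast
    show "|{..<x}| <o |K|" if "x \<in> K" for x
      using K(4)[OF that] kK by (rule ordLess_ordIso_trans)
    show "|{..<x}| \<le>o |K|" if "x \<in> W" for x
      using W(4)[OF that] cardSuc_ordLeq_ordLess[OF assms(1) card_of_Card_order] kK ordLeq_ordIso_trans by blast
    show "|K| <o |W|"
      using K(2) cardSuc_greater[OF assms(1)] W(2)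
      by (meson ordIso_ordLess_trans ordIso_symmetric ordLess_ordIso_trans)
    show "y \<in> W" if "x \<in> W" "y < x" for x y
      using that by (rule W(3))
    show "y \<in> K" if "x \<in> K" "y < x" for x y
      using that by (rule K(3))
  qed
  obtain F where F: "\<forall>A B. unbounded A \<longrightarrow> unbounded B \<longrightarrow> (\<forall>\<gamma>\<in>W. \<exists>\<alpha>\<in>A. \<exists>\<beta>\<in>B. \<alpha> < \<beta> \<and> F \<alpha> \<beta> = \<gamma>)"
    using rectangular_colouring ..
  have unbounded: "unbounded (h ` A)" if "A \<subseteq> Field ?r" "|A| =o ?r" for A
  proof (rule card_unbounded)
    show "h ` A \<subseteq> W"
      using that(1) unfolding W_def by blast
    have "inj_on h A"
      using W(1) that(1) by (rule inj_on_subset)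
    then have "|h ` A| =o |A|"
      using card_of_ordIsoI ordIso_symmetric by (metis bij_betw_imageI)
    then show "|h ` A| =o |W|"
      using that(2) W(2) by (meson ordIso_symmetric ordIso_transitive)
  qed
  define F' where "F' \<alpha> \<beta> = inv_into (Field ?r) h (F (h \<alpha>) (h \<beta>))" for \<alpha> \<beta>
  have "\<exists>(\<alpha>, \<beta>)\<in>circ_pairs ?r A B. F' \<alpha> \<beta> = \<gamma>"
    if A: "A \<subseteq> Field ?r" "|A| =o ?r" and B: "B \<subseteq> Field ?r" "|B| =o ?r" and \<gamma>: "\<gamma> \<in> Field ?r" for A B \<gamma>
  proof -
    have "h \<gamma> \<in> W"
      using \<gamma> unfolding W_def by blast
    then have "\<exists>\<alpha>\<in>h ` A. \<exists>\<beta>\<in>h ` B. \<alpha> < \<beta> \<and> F \<alpha> \<beta> = h \<gamma>"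
      using F[rule_format, OF unbounded[OF A] unbounded[OF B]] by simp
    then obtain \<alpha> \<beta> where *: "\<alpha> \<in> A" "\<beta> \<in> B" "h \<alpha> < h \<beta>" "F (h \<alpha>) (h \<beta>) = h \<gamma>"
      by blast
    have "F' \<alpha> \<beta> = \<gamma>"
      unfolding F'_def *(4) using W(1) \<gamma> by (rule inv_into_f_f)
    moreover have "(\<alpha>, \<beta>) \<in> circ_pairs ?r A B"
      unfolding circ_pairs_def using W(5)[OF _ _ *(3)] *(1,2) A(1) B(1) by blast
    ultimately show ?thesis
      by blast
  qed
  then show ?thesis
    by (intro exI[of _ F'] allI impI ballI)
qed

text \<open>A colour of \<open>F\<close> codes an index and a finite list of colours, and
  \<open>f\<close> reads the list at the class of the pair under that partition. A pair whose colour
  codes \<open>\<delta>\<close> and the values of \<open>\<zeta>\<close> below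
  \<open>N \<delta>\<close> is as required.\<close>

theorem neg_arrow_circ_cardSuc:
  fixes k :: "'a rel" and I :: "'i set"
  assumes k: "Card_order k" "infinite (Field k)" "regularCard k"
    and I: "I \<noteq> {}" "|I| \<le>o cardSuc k"
    and P: "\<And>\<delta> \<alpha> \<beta>. \<delta> \<in> I \<Longrightarrow> (\<alpha>, \<beta>) \<in> cardSuc k \<Longrightarrow> \<alpha> \<noteq> \<beta> \<Longrightarrow> P \<delta> \<alpha> \<beta> < N \<delta>"
  shows "neg_arrow_circ (cardSuc k) P N I (cardSuc k) (cardSuc k) (Field (cardSuc k))"
proof -
  let ?W = "Field (cardSuc k)"
  obtain F where F: "\<forall>A B. A \<subseteq> ?W \<longrightarrow> B \<subseteq> ?W \<longrightarrow> |A| =o cardSuc k \<longrightarrow> |B| =o cardSuc k \<longrightarrow>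
      (\<forall>\<gamma>\<in>?W. \<exists>(\<alpha>, \<beta>)\<in>circ_pairs (cardSuc k) A B. F \<alpha> \<beta> = \<gamma>)"
    using cardSuc_rectangular_colouring[OF k] ..
  have inf: "infinite ?W"
    using k by (simp add: cardSuc_finite)
  have W: "cardSuc k =o |?W|"
    using card_of_Field_ordIso[OF cardSuc_Card_order[OF k(1)]] by (rule ordIso_symmetric)
  have "|I \<times> lists ?W| \<le>o |?W|"
  proof (rule card_of_Sigma_ordLeq_infinite[OF inf])
    show "|I| \<le>o |?W|"
      using I(2) W by (rule ordLeq_ordIso_trans)
    show "\<forall>i\<in>I. |lists ?W| \<le>o |?W|"
      using card_of_lists_ordLeq_infinite[OF inf] card_of_mono1[of ?W ?W] by blast
  qed
  moreover have "I \<times> lists ?W \<noteq> {}"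
    using I(1) by auto
  ultimately have "\<exists>q. q ` ?W = I \<times> lists ?W"
    using card_of_ordLeq2[of "I \<times> lists ?W" ?W] by simp
  then obtain q where q: "q ` ?W = I \<times> lists ?W" ..
  obtain w where w: "w \<in> ?W"
    using inf by fastforce
  \<comment> \<open>\<open>w\<close> is a default that keeps the colour in the field when the list
    is too short.\<close>
  define f where "f \<alpha> \<beta> = (let (\<delta>, z) = q (F \<alpha> \<beta>); x = z ! P \<delta> \<alpha> \<beta> in if x \<in> ?W then x else w)" for \<alpha> \<beta>
  have "f \<alpha> \<beta> \<in> ?W" for \<alpha> \<beta>
    using w by (simp add: f_def Let_def split_beta)
  moreover have "strong_pairs ?W f (P \<delta>) (N \<delta>) (circ_pairs (cardSuc k) A B)"
    if \<delta>: "\<delta> \<in> I" and AB: "A \<subseteq> ?W" "B \<subseteq> ?W" "|A| =o cardSuc k" "|B| =o cardSuc k" for \<delta> A B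
    unfolding strong_pairs_def
  proof (intro allI impI)
    fix \<zeta> :: "nat \<Rightarrow> 'a set" assume \<zeta>: "\<forall>i<N \<delta>. \<zeta> i \<in> ?W"
    then have "(\<delta>, map \<zeta> [0..<N \<delta>]) \<in> q ` ?W"
      unfolding q using \<delta> by auto
    then obtain \<gamma> where \<gamma>: "\<gamma> \<in> ?W" "q \<gamma> = (\<delta>, map \<zeta> [0..<N \<delta>])"
      by (metis imageE)
    obtain \<alpha> \<beta> where *: "(\<alpha>, \<beta>) \<in> circ_pairs (cardSuc k) A B" "F \<alpha> \<beta> = \<gamma>"
      using F[rule_format, OF AB \<gamma>(1)] by blast
    then have "P \<delta> \<alpha> \<beta> < N \<delta>"
      using P[OF \<delta>] unfolding circ_pairs_def by blast
    then have "f \<alpha> \<beta> = \<zeta> (P \<delta> \<alpha> \<beta>)"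
      using \<zeta> by (simp add: f_def *(2) \<gamma>(2))
    then show "\<exists>(\<alpha>, \<beta>)\<in>circ_pairs (cardSuc k) A B. f \<alpha> \<beta> = \<zeta> (P \<delta> \<alpha> \<beta>)"
      using *(1) by blast
  qed
  ultimately show ?thesis
    unfolding neg_arrow_circ_def by (intro exI[of _ f] conjI ballI allI impI)
qed

section \<open>From rectangles to squares, and the cases of kappa^+ and of the first uncountable
  cardinal\<close>

lemma neg_arrow_circ_imp_sq:
  assumes "neg_arrow_circ r P N I mu mu cols"
  shows "neg_arrow_sq r P N I mu cols"
proof -
  obtain f where "\<forall>\<alpha>\<in>Field r. \<forall>\<beta>\<in>Field r. f \<alpha> \<beta> \<in> cols"
    and f: "\<forall>\<delta>\<in>I. \<forall>A B. A \<subseteq> Field r \<longrightarrow> B \<subseteq> Field r \<longrightarrow> |A| =o mu \<longrightarrow> |B| =o mu \<longrightarrow>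
      strong_pairs cols f (P \<delta>) (N \<delta>) (circ_pairs r A B)"
    using assms unfolding neg_arrow_circ_def by (elim exE conjE)
  then show ?thesis
    unfolding neg_arrow_sq_def by (intro exI[of _ f]) simp
qed

theorem theorem4p3:
  "(\<forall>(k :: 'a rel) (P :: 'a set \<Rightarrow> 'a set \<Rightarrow> 'a set \<Rightarrow> nat) (N :: 'a set \<Rightarrow> nat).
      Card_order k \<and> \<not> finite (Field k) \<and> regularCard k \<and>
      (\<forall>\<delta>\<in>Field (cardSuc k). \<forall>\<alpha>\<in>Field (cardSuc k). \<forall>\<beta>\<in>Field (cardSuc k).
          (\<alpha>,\<beta>) \<in> cardSuc k \<and> \<alpha> \<noteq> \<beta> \<longrightarrow> P \<delta> \<alpha> \<beta> < N \<delta>)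
      \<longrightarrow> neg_arrow_circ (cardSuc k) P N (Field (cardSuc k))
            (cardSuc k) (cardSuc k) (Field (cardSuc k)))
   \<and>
   (\<forall>(p :: nat set \<Rightarrow> nat set \<Rightarrow> nat) (n :: nat).
      (\<forall>\<alpha>\<in>Field (cardSuc natLeq). \<forall>\<beta>\<in>Field (cardSuc natLeq).
          (\<alpha>,\<beta>) \<in> cardSuc natLeq \<and> \<alpha> \<noteq> \<beta> \<longrightarrow> p \<alpha> \<beta> < n)
      \<longrightarrow> neg_arrow_circ (cardSuc natLeq) (\<lambda>_::unit. p) (\<lambda>_. n) UNIV
            (cardSuc natLeq) (cardSuc natLeq) (Field (cardSuc natLeq))
        \<and> neg_arrow_sq (cardSuc natLeq) (\<lambda>_::unit. p) (\<lambda>_. n) UNIV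
            (cardSuc natLeq) (Field (cardSuc natLeq)))"
proof (intro conjI allI impI)
  fix k :: "'a rel" and P :: "'a set \<Rightarrow> 'a set \<Rightarrow> 'a set \<Rightarrow> nat" and N :: "'a set \<Rightarrow> nat"
  assume H: "Card_order k \<and> \<not> finite (Field k) \<and> regularCard k \<and>
      (\<forall>\<delta>\<in>Field (cardSuc k). \<forall>\<alpha>\<in>Field (cardSuc k). \<forall>\<beta>\<in>Field (cardSuc k).
          (\<alpha>,\<beta>) \<in> cardSuc k \<and> \<alpha> \<noteq> \<beta> \<longrightarrow> P \<delta> \<alpha> \<beta> < N \<delta>)"
  show "neg_arrow_circ (cardSuc k) P N (Field (cardSuc k)) (cardSuc k) (cardSuc k) (Field (cardSuc k))"
  proof (rule neg_arrow_circ_cardSuc)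
    show "Field (cardSuc k) \<noteq> {}"
      using H Field_cardSuc_not_empty by blast
    show "|Field (cardSuc k)| \<le>o cardSuc k"
      using H card_of_Field_ordIso[OF cardSuc_Card_order] ordIso_imp_ordLeq by blast
    show "P \<delta> \<alpha> \<beta> < N \<delta>" if "\<delta> \<in> Field (cardSuc k)" "(\<alpha>, \<beta>) \<in> cardSuc k" "\<alpha> \<noteq> \<beta>" for \<delta> \<alpha> \<beta>
      using H that FieldI1[OF that(2)] FieldI2[OF that(2)] by blast
  qed (use H in auto)
next
  fix p :: "nat set \<Rightarrow> nat set \<Rightarrow> nat" and n :: nat
  assume H: "\<forall>\<alpha>\<in>Field (cardSuc natLeq). \<forall>\<beta>\<in>Field (cardSuc natLeq).
      (\<alpha>,\<beta>) \<in> cardSuc natLeq \<and> \<alpha> \<noteq> \<beta> \<longrightarrow> p \<alpha> \<beta> < n"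
  \<comment> \<open>A single partition is a sequence indexed by the one-element type
    \<open>unit\<close>.\<close>
  show circ: "neg_arrow_circ (cardSuc natLeq) (\<lambda>_::unit. p) (\<lambda>_. n) UNIV
      (cardSuc natLeq) (cardSuc natLeq) (Field (cardSuc natLeq))"
  proof (rule neg_arrow_circ_cardSuc)
    show "infinite (Field natLeq)"
      by (simp add: Field_natLeq)
    show "regularCard natLeq"
      by (rule regularCard_natLeq)
    have "|UNIV :: unit set| \<le>o |Field (cardSuc natLeq)|"
      using Field_cardSuc_not_empty[OF natLeq_Card_order] by (simp add: UNIV_unit card_of_singl_ordLeq)
    then show "|UNIV :: unit set| \<le>o cardSuc natLeq"
      using card_of_Field_ordIso[OF cardSuc_Card_order[OF natLeq_Card_order]] ordLeq_ordIso_trans by blast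
    show "p \<alpha> \<beta> < n" if "(\<alpha>, \<beta>) \<in> cardSuc natLeq" "\<alpha> \<noteq> \<beta>" for \<alpha> \<beta>
      using H that FieldI1[OF that(1)] FieldI2[OF that(1)] by blast
  qed (use natLeq_Card_order in auto)
  then show "neg_arrow_sq (cardSuc natLeq) (\<lambda>_::unit. p) (\<lambda>_. n) UNIV
      (cardSuc natLeq) (Field (cardSuc natLeq))"
    by (rule neg_arrow_circ_imp_sq)
qed

end
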